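(* Let $m>1$ and $N=2$. Let $u_0:\mathbb{R}^2\to[0,\infty)$ be bounded, continuous and radially symmetric, with $$u_0(0)=K>0,\qquad \lim_{|x|\to\infty}u_0(x)=0,$$ and let $u$ be the solution of the Cauchy problem $|x|^{-2}\partial_t u=\Delta u^m$ in $\mathbb{R}^2\times(0,\infty)$, $u(x,0)=u_0(x)$. Then there exists a radially symmetric profile of the form $$W(x,t)=f\!\left(\frac{\log|x|}{\sqrt t}\right),\qquad W(0,t)=K\ \text{ for every } t>0,$$ for some function $f$, such that $$\lim_{t\to\infty}\|u(\cdot,t)-W(\cdot,t)\|_{L^\infty(\mathbb{R}^2)}=0.$$ Moreover $u(0,t)=K$ for every $t>0$.
   Context: A (radial) solution of the Cauchy problem $|x|^{-2}\partial_t u=\Delta u^m$, $u(\cdot,0)=u_0$, with $u_0$ bounded, continuous, nonnegative and radially symmetric, is a nonnegative, radially symmetric function $u$, continuous in $\mathbb{R}^N\times(0,\infty)$ and bounded on $\mathbb{R}^N\times[0,T]$ for every $T<\infty$, such that for every $0<r_1<r_2$, $T>0$ and every $\varphi\in C^{2,1}((r_1,r_2)\times(0,T))$, $\varphi\ge0$, with $\varphi(r_1,t)=\varphi(r_2,t)=0$, $$\int_0^T\!\!\int_{r_1}^{r_2}\Big[r^{-2}u\varphi_t+\big(\varphi_{rr}+\tfrac{N-1}{r}\varphi_r\big)u^m\Big]r^{N-1}dr\,dt=\int_{r_1}^{r_2}r^{-2}\big[u(r,T)\varphi(r,T)-u_0(r)\varphi(r,0)\big]r^{N-1}dr+\int_0^T\big[r_2^{N-1}u^m(r_2,t)\varphi_r(r_2,t)-r_1^{N-1}u^m(r_1,t)\varphi_r(r_1,t)\big]dt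 .$$ Such a solution exists and is unique. *)

theory Defs
  imports "HOL-Analysis.Analysis"
begin

definition e1 :: "'a::euclidean_space" where
  "e1 = (SOME b. b \<in> Basis)"

definition rprof :: "('a::euclidean_space \<Rightarrow> real \<Rightarrow> real) \<Rightarrow> real \<Rightarrow> real \<Rightarrow> real" where
  "rprof u r t = u (r *\<^sub>R e1) t"

definition radial :: "('a::real_normed_vector \<Rightarrow> 'b) \<Rightarrow> bool" where
  "radial g \<longleftrightarrow> (\<forall>x y. norm x = norm y \<longrightarrow> g x = g y)"

definition C21_rect ::
  "real \<Rightarrow> real \<Rightarrow> real \<Rightarrow> (real \<Rightarrow> real \<Rightarrow> real) \<Rightarrow> (real \<Rightarrow> real \<Rightarrow> real)
   \<Rightarrow> (real \<Rightarrow> real \<Rightarrow> real) \<Rightarrow> (real \<Rightarrow> real \<Rightarrow> real) \<Rightarrow> bool" where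
  "C21_rect r1 r2 T phi phr phrr pht \<longleftrightarrow>
     (\<forall>r\<in>{r1..r2}. \<forall>t\<in>{0..T}.
        ((\<lambda>s. phi s t) has_real_derivative phr r t) (at r within {r1..r2}) \<and>
        ((\<lambda>s. phr s t) has_real_derivative phrr r t) (at r within {r1..r2}) \<and>
        ((\<lambda>s. phi r s) has_real_derivative pht r t) (at t within {0..T})) \<and>
     continuous_on ({r1..r2} \<times> {0..T}) (\<lambda>(r,t). phi r t) \<and>
     continuous_on ({r1..r2} \<times> {0..T}) (\<lambda>(r,t). phr r t) \<and>
     continuous_on ({r1..r2} \<times> {0..T}) (\<lambda>(r,t). phrr r t) \<and>
     continuous_on ({r1..r2} \<times> {0..T}) (\<lambda>(r,t). pht r t)"

text \<open>Radial (weak) solution of |x|^{-2} u_t = Delta u^m with u(.,0) = u0,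
  in dimension N = DIM('a), as in the paper.\<close>
definition radial_solution ::
  "real \<Rightarrow> ('a::euclidean_space \<Rightarrow> real) \<Rightarrow> ('a \<Rightarrow> real \<Rightarrow> real) \<Rightarrow> bool" where
  "radial_solution m u0 u \<longleftrightarrow>
     (let N = real DIM('a); U = rprof u; U0 = (\<lambda>r. u0 (r *\<^sub>R e1)) in
     (\<forall>x t. 0 \<le> u x t) \<and>
     (\<forall>t. radial (\<lambda>x. u x t)) \<and>
     continuous_on (UNIV \<times> {0<..}) (\<lambda>(x,t). u x t) \<and>
     (\<forall>T. bounded ((\<lambda>(x,t). u x t) ` (UNIV \<times> {0..T}))) \<and>
     (\<forall>r1 r2 T phi phr phrr pht.
        0 < r1 \<and> r1 < r2 \<and> 0 < T \<and> C21_rect r1 r2 T phi phr phrr pht \<and>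
        (\<forall>r\<in>{r1..r2}. \<forall>t\<in>{0..T}. 0 \<le> phi r t) \<and>
        (\<forall>t\<in>{0..T}. phi r1 t = 0 \<and> phi r2 t = 0) \<longrightarrow>
        integral {0..T} (\<lambda>t. integral {r1..r2} (\<lambda>r.
            (U r t * pht r t / r\<^sup>2 + (phrr r t + (N - 1) / r * phr r t) * U r t powr m)
            * r powr (N - 1)))
        = integral {r1..r2} (\<lambda>r. (U r T * phi r T - U0 r * phi r 0) / r\<^sup>2 * r powr (N - 1))
          + integral {0..T} (\<lambda>t. r2 powr (N - 1) * U r2 t powr m * phr r2 t
                                 - r1 powr (N - 1) * U r1 t powr m * phr r1 t)))"

end

theory Submission
  imports Defs
begin

text \<open>With \<open>s = ln r\<close> the equation is the one-dimensional porous medium equation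
  \<open>v\<^sub>t = (v\<^sup>m)\<^sub>s\<^sub>s\<close>. Integrated in time, the very weak formulation says that a second primitive
  \<open>Q\<close> of \<open>v\<close> in \<open>s\<close> is a classical solution of the fully nonlinear equation
  \<open>Q\<^sub>t = (Q\<^sub>s\<^sub>s)\<^sup>m\<close>, so the pointwise maximum principle applies. Differences of such \<open>Q\<close> stay
  below barriers \<open>b cosh(\<theta>(s - s0)) exp(c\<theta>\<^sup>2t) + C\<close>, and they stay convex if initially convex;
  the latter is the comparison principle for \<open>v\<close>. Comparing \<open>v\<close> with its time rescalings shows that
  \<open>t\<^bsup>1/(m-1)\<^esup> v\<close> is nondecreasing in \<open>t\<close>, hence \<open>v\<^sup>m\<close> is semiconvex in \<open>s\<close> with constant \<open>O(1/t)\<close> and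
  \<open>s \<mapsto> v(s \<surd>t, t)\<close> is equicontinuous. The barriers with \<open>\<theta> = 1/\<surd>t\<close> show that \<open>v\<close> and its dilation
  \<open>v(as, a\<^sup>2t)\<close> are uniformly close for large \<open>t\<close>, uniformly in \<open>a \<ge> 1\<close>. So \<open>v(s \<surd>t, t)\<close> is
  uniformly Cauchy as \<open>t \<rightarrow> \<infinity>\<close> and its limit is the profile \<open>f\<close>; no self-similar solution has to be
  constructed beforehand. Comparison with the constant \<open>K\<close> near \<open>s = -\<infinity>\<close> gives the value at the
  origin.\<close>

section \<open>Maximum principles\<close>

text \<open>If \<open>c\<close> were positive, \<open>f'\<close> would vanish at \<open>x\<close>
  and be positive just to the right of it, so the mean value theorem would make \<open>f\<close>
  exceed \<open>f x\<close> there.\<close>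

lemma second_derivative_at_max_nonpos:
  fixes f :: "real \<Rightarrow> real"
  assumes f: "\<And>y. (f has_real_derivative f' y) (at y)"
    and f': "(f' has_real_derivative c) (at x)"
    and d: "d > 0" and max: "\<And>y. \<bar>y - x\<bar> < d \<Longrightarrow> f y \<le> f x"
  shows "c \<le> 0"
proof (rule ccontr)
  assume "\<not> c \<le> 0"
  have 0: "f' x = 0"
    by (rule DERIV_local_max[OF f d]) (use max in \<open>auto simp: abs_minus_commute\<close>)
  from DERIV_pos_inc_right[OF f'] \<open>\<not> c \<le> 0\<close> obtain e where e: "e > 0"
    and inc: "\<And>h. 0 < h \<Longrightarrow> h < e \<Longrightarrow> f' x < f' (x + h)" by auto
  define h where "h = min d e / 2"
  have h: "0 < h" "h < d" "h < e" using d e by (auto simp: h_def)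
  have "\<exists>z. x < z \<and> z < x + h \<and> f (x + h) - f x = (x + h - x) * f' z"
    by (rule MVT2) (use h f in auto)
  then obtain z where z: "x < z" "z < x + h" "f (x + h) - f x = h * f' z" by auto
  have "f' z > 0" using inc[of "z - x"] z h 0 by auto
  then have "f (x + h) > f x" using z(3) h by (smt (verit) mult_pos_pos)
  moreover have "f (x + h) \<le> f x" using max[of "x + h"] h by auto
  ultimately show False by simp
qed

text \<open>A maximum over a time interval may sit at the final time, so only earlier times are
  compared and the conclusion is one-sided.\<close>

lemma derivative_at_left_max_nonneg:
  fixes f :: "real \<Rightarrow> real"
  assumes f: "(f has_real_derivative c) (at t)"
    and "a < t" and max: "\<And>y. a \<le> y \<Longrightarrow> y \<le> t \<Longrightarrow> f y \<le> f t"
  shows "0 \<le> c"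
proof (rule ccontr)
  assume "\<not> 0 \<le> c"
  with DERIV_neg_dec_left[OF f] obtain e where e: "e > 0"
    and dec: "\<And>h. 0 < h \<Longrightarrow> h < e \<Longrightarrow> f t < f (t - h)" by auto
  define h where "h = min (t - a) e / 2"
  have h: "0 < h" "h < t - a" "h < e" using assms(2) e by (auto simp: h_def)
  show False using dec[of h] max[of "t - h"] h by auto
qed

text \<open>Two mean value theorems, first for \<open>f (y + k) - f y\<close>, then for
  \<open>f'\<close>. This turns closeness of second primitives into closeness of the functions
  themselves.\<close>

lemma second_difference_mvt:
  fixes f :: "real \<Rightarrow> real"
  assumes f: "\<And>y. (f has_real_derivative f' y) (at y)"
    and f': "\<And>y. (f' has_real_derivative f'' y) (at y)" and k: "k > 0"
  obtains \<xi> where "\<bar>\<xi> - s\<bar> \<le> k" "f (s + k) + f (s - k) - 2 * f s = k\<^sup>2 * f'' \<xi>"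
proof -
  have "\<exists>z. s - k < z \<and> z < s \<and> (f (s + k) - f s) - (f (s - k + k) - f (s - k))
      = (s - (s - k)) * (f' (z + k) - f' z)"
    by (rule MVT2) (use k in \<open>auto intro!: derivative_eq_intros f DERIV_chain2[OF f]\<close>)
  then obtain z where z: "s - k < z" "z < s"
      "f (s + k) + f (s - k) - 2 * f s = k * (f' (z + k) - f' z)" by auto
  have "\<exists>\<xi>. z < \<xi> \<and> \<xi> < z + k \<and> f' (z + k) - f' z = (z + k - z) * f'' \<xi>"
    by (rule MVT2) (use k f' in auto)
  then obtain \<xi> where \<xi>: "z < \<xi>" "\<xi> < z + k" "f' (z + k) - f' z = k * f'' \<xi>" by auto
  show thesis by (rule that[of \<xi>]) (use z \<xi> in \<open>auto simp: power2_eq_square\<close>)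
qed

lemma cosh_ge_quadratic: "1 + x\<^sup>2 / 4 \<le> cosh (x::real)"
proof -
  have *: "1 + x\<^sup>2 / 4 \<le> cosh x" if "0 \<le> x" for x :: real
    using exp_lower_Taylor_quadratic[OF that] exp_ge_add_one_self[of "-x"]
    by (simp add: cosh_field_def)
  show ?thesis using *[of x] *[of "-x"] by (cases "0 \<le> x") auto
qed

lemma cosh_ge_abs: "\<bar>x\<bar> \<le> cosh (x::real)"
proof -
  have "0 \<le> (\<bar>x\<bar> / 2 - 1)\<^sup>2" by simp
  then show ?thesis using cosh_ge_quadratic[of x]
    by (simp add: power2_eq_square algebra_simps)
qed

text \<open>Obtained by squaring \<open>x\<^sup>2 / 8 \<le> exp (\<bar>x\<bar> / 2)\<close>. A power
  above the second lets cosh absorb any multiple of a parabola far out.\<close>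

lemma cosh_ge_quartic: "x ^ 4 / 128 \<le> cosh (x::real)"
proof -
  have "x\<^sup>2 / 8 \<le> exp (\<bar>x\<bar> / 2)"
    using exp_lower_Taylor_quadratic[of "\<bar>x\<bar> / 2"] by (simp add: power_divide)
  then have "(x\<^sup>2 / 8)\<^sup>2 \<le> (exp (\<bar>x\<bar> / 2))\<^sup>2" by (intro power_mono) auto
  also have "\<dots> = exp \<bar>x\<bar>" by (simp add: power2_eq_square flip: exp_add)
  also have "\<dots> \<le> 2 * cosh x"
    by (cases "0 \<le> x") (auto simp: cosh_field_def)
  finally show ?thesis by (simp add: power_divide)
qed

section \<open>Barriers for a one-sided parabolic inequality\<close>

text \<open>The barrier grows in time at rate \<open>(L + 1) * \<theta>\<^sup>2\<close>, strictly
  faster than the rate \<open>L * \<theta>\<^sup>2\<close> permitted by the bound on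
  \<open>g\<close>, so \<open>D\<close> cannot exceed it at a positive maximum of the difference.
  The growth hypothesis, with a constant \<open>C'\<close> that may be much larger than
  \<open>C\<close>, makes such a maximum exist.\<close>

lemma barrier_principle:
  fixes D D' w g :: "real \<Rightarrow> real \<Rightarrow> real"
  assumes cont: "continuous_on (UNIV \<times> {0..T}) (\<lambda>(s,t). D s t)"
    and D1: "\<And>s t. 0 < t \<Longrightarrow> t \<le> T \<Longrightarrow> ((\<lambda>s. D s t) has_real_derivative D' s t) (at s)"
    and D2: "\<And>s t. 0 < t \<Longrightarrow> t \<le> T \<Longrightarrow> ((\<lambda>s. D' s t) has_real_derivative w s t) (at s)"
    and D3: "\<And>s t. 0 < t \<Longrightarrow> t \<le> T \<Longrightarrow> ((\<lambda>t. D s t) has_real_derivative g s t) (at t)"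
    and g: "\<And>s t. 0 < t \<Longrightarrow> t \<le> T \<Longrightarrow> g s t \<le> L * max 0 (w s t)"
    and init: "\<And>s. D s 0 \<le> b * cosh (\<theta> * (s - s0)) + C"
    and growth: "\<And>s t. 0 < t \<Longrightarrow> t \<le> T \<Longrightarrow> D s t \<le> b * cosh (\<theta> * (s - s0)) + C'"
    and b: "0 \<le> b" and \<theta>: "\<theta> > 0" and L: "0 \<le> L" and t: "0 \<le> \<tau>" "\<tau> \<le> T"
  shows "D \<sigma> \<tau> \<le> b * cosh (\<theta> * (\<sigma> - s0)) * exp ((L + 1) * \<theta>\<^sup>2 * \<tau>) + C"
proof (rule ccontr)
  assume neg: "\<not> ?thesis"
  define G where "G = (\<lambda>s t. cosh (\<theta> * (s - s0)) * exp ((L + 1) * \<theta>\<^sup>2 * t))"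
  have Gpos: "G s t > 0" for s t by (simp add: G_def)
  have viol: "D \<sigma> \<tau> - b * G \<sigma> \<tau> - C > 0" using neg by (simp add: G_def mult.assoc)
  \<comment> \<open>Raising \<open>b\<close> by this \<open>e\<close> costs exactly half of the
    violation at \<open>(\<sigma>, \<tau>)\<close>, so the excess \<open>H\<close> is still positive
    there.\<close>
  define e where "e = (D \<sigma> \<tau> - b * G \<sigma> \<tau> - C) / (2 * G \<sigma> \<tau>)"
  have e: "e > 0" using viol Gpos by (simp add: e_def)
  define H where "H = (\<lambda>s t. D s t - (b + e) * G s t - C)"
  have "e * G \<sigma> \<tau> = (D \<sigma> \<tau> - b * G \<sigma> \<tau> - C) / 2"
    using Gpos[of \<sigma> \<tau>] by (simp add: e_def)
  then have Hpos: "H \<sigma> \<tau> > 0" using viol by (simp add: H_def algebra_simps)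
  have Gcosh: "cosh (\<theta> * (s - s0)) \<le> G s t" if "0 \<le> t" for s t
    using that L by (simp add: G_def)
  have H0: "H s 0 < 0" for s
    using init[of s] mult_pos_pos[OF e cosh_real_pos[of "\<theta> * (s - s0)"]]
    by (simp add: H_def G_def distrib_right)
  \<comment> \<open>Beyond distance \<open>r\<close> the extra term \<open>e * cosh\<close>
    outweighs \<open>\<bar>C' - C\<bar>\<close>, because cosh dominates the absolute value.\<close>
  define r where "r = (\<bar>C' - C\<bar> / e + 1) / \<theta>"
  have far: "H s t \<le> 0" if "\<bar>s - s0\<bar> > r" "0 < t" "t \<le> T" for s t
  proof -
    have "\<bar>C' - C\<bar> / e + 1 \<le> \<theta> * \<bar>s - s0\<bar>"
      using that \<theta> by (simp add: r_def field_simps)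
    then have "\<bar>C' - C\<bar> / e \<le> cosh (\<theta> * (s - s0))"
      using cosh_ge_abs[of "\<theta> * (s - s0)"] \<theta> by (simp add: abs_mult)
    then have "\<bar>C' - C\<bar> \<le> e * cosh (\<theta> * (s - s0))" using e by (simp add: field_simps)
    moreover have "(b + e) * cosh (\<theta> * (s - s0)) \<le> (b + e) * G s t"
      using Gcosh[of t s] that b e by (intro mult_left_mono) auto
    ultimately show ?thesis using growth[of t s] that by (simp add: H_def algebra_simps)
  qed
  let ?S = "{s0 - r..s0 + r} \<times> {0..\<tau>}"
  have contH: "continuous_on ?S (\<lambda>(s,t). H s t)"
    unfolding H_def G_def split_beta
    by (intro continuous_intros continuous_on_subset[OF cont[unfolded split_beta]])
      (use t in auto)
  have "\<tau> > 0" using H0[of \<sigma>] Hpos t by (cases "\<tau> = 0") auto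
  have "\<bar>\<sigma> - s0\<bar> \<le> r" using far[of \<sigma> \<tau>] Hpos t \<open>\<tau> > 0\<close> by fastforce
  then have mem: "(\<sigma>, \<tau>) \<in> ?S" using t by auto
  obtain s1 t1 where st: "(s1, t1) \<in> ?S" and max: "\<And>s t. (s, t) \<in> ?S \<Longrightarrow> H s t \<le> H s1 t1"
    using continuous_attains_sup[OF _ _ contH] mem
    by (auto simp: compact_Times)
  have H1: "H s1 t1 > 0" using max[OF mem] Hpos by simp
  then have t1: "0 < t1" "t1 \<le> T" using H0[of s1] st t by (cases "t1 = 0"; auto)+
  have maxs: "H s t \<le> H s1 t1" if "0 \<le> t" "t \<le> \<tau>" for s t
  proof (cases "\<bar>s - s0\<bar> \<le> r")
    case True
    then show ?thesis using that by (intro max) auto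
  next
    case False
    then show ?thesis using far[of s t] H0[of s] H1 that t by (cases "t = 0") auto
  qed
  \<comment> \<open>\<open>\<beta>\<close> is the second space derivative of the raised barrier at
    the maximum. There \<open>w \<le> \<beta>\<close> and \<open>g \<ge> (L + 1) * \<beta>\<close>,
    which contradicts \<open>g \<le> L * max 0 w\<close> since \<open>\<beta>\<close> is
    positive.\<close>
  define \<beta> where "\<beta> = (b + e) * \<theta>\<^sup>2 * G s1 t1"
  have \<beta>: "\<beta> > 0" using b e \<theta> Gpos by (simp add: \<beta>_def)
  have "w s1 t1 - \<beta> \<le> 0"
  proof (rule second_derivative_at_max_nonpos)
    show "((\<lambda>s. H s t1) has_real_derivative
        D' y t1 - (b + e) * (\<theta> * sinh (\<theta> * (y - s0)) * exp ((L + 1) * \<theta>\<^sup>2 * t1))) (at y)" for y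
      unfolding H_def G_def by (auto intro!: derivative_eq_intros D1 t1)
    show "((\<lambda>y. D' y t1 - (b + e) * (\<theta> * sinh (\<theta> * (y - s0)) * exp ((L + 1) * \<theta>\<^sup>2 * t1)))
        has_real_derivative w s1 t1 - \<beta>) (at s1)"
      unfolding \<beta>_def G_def by (auto intro!: derivative_eq_intros D2 t1 simp: power2_eq_square)
    show "H y t1 \<le> H s1 t1" for y using maxs[of t1 y] st by auto
  qed (rule zero_less_one)
  moreover have "0 \<le> g s1 t1 - (L + 1) * \<beta>"
  proof (rule derivative_at_left_max_nonneg)
    show "((\<lambda>t. H s1 t) has_real_derivative g s1 t1 - (L + 1) * \<beta>) (at t1)"
      unfolding H_def G_def \<beta>_def by (auto intro!: derivative_eq_intros D3 t1)
    show "H s1 y \<le> H s1 t1" if "0 \<le> y" "y \<le> t1" for y using maxs[of y s1] st that by auto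
  qed (rule t1)
  moreover have "L * max 0 (w s1 t1) \<le> L * \<beta>"
    using calculation(1) \<beta> L by (intro mult_left_mono) auto
  ultimately show False using g[of t1 s1] t1 \<beta> by (simp add: algebra_simps)
qed

section \<open>Preservation of convexity\<close>

text \<open>A second derivative bounded below by \<open>- N\<close> allows a gap above a chord of at
  most the first term; the lemma confines the endpoints for which the cosh penalty does not outweigh
  it. The bound stays uniform when an endpoint has a small weight, because the factor
  \<open>l * (1 - l)\<close> is then equally small.\<close>

lemma cosh_dominates_chord:
  fixes N \<epsilon> :: real
  assumes N: "N \<ge> 0" and e: "\<epsilon> > 0"
  obtains r where "\<And>x y l. 0 \<le> l \<Longrightarrow> l \<le> 1 \<Longrightarrow>
    0 < N * (l * (1 - l) * (x - y)\<^sup>2 / 2) - \<epsilon> * (l * cosh x + (1 - l) * cosh y) \<Longrightarrow> \<bar>x\<bar> \<le> r \<and> \<bar>y\<bar> \<le> r"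
proof -
  define k where "k = 64 * N\<^sup>2 / \<epsilon>"
  have k0: "k \<ge> 0" using e by (simp add: k_def)
  \<comment> \<open>The constant \<open>k\<close> comes from completing the square in
    \<open>s\<^sup>2\<close> against the quartic lower bound of cosh.\<close>
  have k: "N * s\<^sup>2 \<le> \<epsilon> * cosh s / 2 + k" for s
  proof -
    have "0 \<le> (\<epsilon> * s\<^sup>2 - 128 * N)\<^sup>2" by simp
    then have "N * s\<^sup>2 \<le> \<epsilon> * s ^ 4 / 256 + k"
      using e by (simp add: k_def field_simps power2_eq_square power4_eq_xxxx)
    also have "\<dots> \<le> \<epsilon> * cosh s / 2 + k"
      using mult_left_mono[OF cosh_ge_quartic[of s], of "\<epsilon> / 2"] e by simp
    finally show ?thesis .
  qed
  define r1 where "r1 = 4 * k / \<epsilon>"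
  define r2 where "r2 = 2 * (k + N * r1\<^sup>2) / \<epsilon>"
  \<comment> \<open>By symmetry the heavier endpoint may be taken to be \<open>x\<close>. It is
    bounded first, and its bound then enters that of \<open>y\<close>.\<close>
  have half: "\<bar>x\<bar> \<le> r1 \<and> \<bar>y\<bar> \<le> r2" if l: "1 / 2 \<le> l" "l \<le> 1"
    and pos: "0 < N * (l * (1 - l) * (x - y)\<^sup>2 / 2) - \<epsilon> * (l * cosh x + (1 - l) * cosh y)" for x y l
  proof -
    have "(x - y)\<^sup>2 / 2 \<le> x\<^sup>2 + y\<^sup>2"
      using zero_le_power2[of "x + y"] by (simp add: power2_eq_square algebra_simps)
    then have "(N * (l * (1 - l))) * ((x - y)\<^sup>2 / 2) \<le> (N * (l * (1 - l))) * (x\<^sup>2 + y\<^sup>2)"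
      using l N by (intro mult_left_mono) auto
    then have *: "0 < (l * (1 - l)) * (N * x\<^sup>2) + (l * (1 - l)) * (N * y\<^sup>2)
        - \<epsilon> * (l * cosh x + (1 - l) * cosh y)"
      using pos by (simp add: algebra_simps)
    have l1: "l * (1 - l) \<le> 1 - l" "l * (1 - l) \<le> l" using l by (auto simp: mult_left_le_one_le mult_left_le)
    have le1: "(l * (1 - l)) * (N * y\<^sup>2) \<le> (1 - l) * (N * y\<^sup>2)" for y
      using l1 N by (intro mult_right_mono) auto
    have le2: "(l * (1 - l)) * (N * x\<^sup>2) \<le> l * (N * x\<^sup>2)"
      using l1 N by (intro mult_right_mono) auto
    have "l * (N * x\<^sup>2) \<le> l * (\<epsilon> * cosh x / 2 + k)" "(1 - l) * (N * y\<^sup>2) \<le> (1 - l) * (\<epsilon> * cosh y / 2 + k)"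
      using k l by (auto intro!: mult_left_mono)
    then have "0 < l * (\<epsilon> * cosh x / 2 + k) + (1 - l) * (\<epsilon> * cosh y / 2 + k)
        - \<epsilon> * (l * cosh x + (1 - l) * cosh y)"
      using * le1[of y] le2 by linarith
    then have "0 < k - \<epsilon> * (l * cosh x) / 2 - \<epsilon> * ((1 - l) * cosh y) / 2"
      by (simp add: field_simps)
    moreover have "0 \<le> \<epsilon> * ((1 - l) * cosh y) / 2" using l e by auto
    moreover have "\<epsilon> * (cosh x / 2) \<le> \<epsilon> * (l * cosh x)"
      using l e by (intro mult_left_mono) auto
    ultimately have "\<epsilon> * cosh x \<le> 4 * k" by simp
    then have x: "\<bar>x\<bar> \<le> r1"
      using cosh_ge_abs[of x] e by (simp add: r1_def field_simps) (smt (verit) mult_left_mono)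
    \<comment> \<open>Dropping the penalty at \<open>x\<close> leaves a common factor
      \<open>1 - l\<close>; after cancelling it, the bound for \<open>y\<close> does not degenerate
      as \<open>l\<close> tends to 1.\<close>
    have "0 \<le> \<epsilon> * (l * cosh x)" using l e by auto
    then have "0 < (1 - l) * (N * x\<^sup>2) + (1 - l) * (N * y\<^sup>2) - \<epsilon> * ((1 - l) * cosh y)"
      using * le1[of y] le1[of x] by (simp add: algebra_simps)
    then have "0 < (1 - l) * (N * x\<^sup>2 + N * y\<^sup>2 - \<epsilon> * cosh y)" by (simp add: algebra_simps)
    then have "0 < N * x\<^sup>2 + N * y\<^sup>2 - \<epsilon> * cosh y" using l by (simp add: zero_less_mult_iff)
    moreover have "N * x\<^sup>2 \<le> N * r1\<^sup>2"
      using x N power_mono[of "\<bar>x\<bar>" r1 2] by (intro mult_left_mono) auto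
    ultimately have "\<epsilon> * cosh y \<le> 2 * (k + N * r1\<^sup>2)" using k[of y] by simp
    then have "\<bar>y\<bar> \<le> r2"
      using cosh_ge_abs[of y] e by (simp add: r2_def field_simps) (smt (verit) mult_left_mono)
    with x show ?thesis by simp
  qed
  show thesis
  proof (rule that[of "max r1 r2"])
    fix x y l :: real
    assume l: "0 \<le> l" "l \<le> 1"
      and pos: "0 < N * (l * (1 - l) * (x - y)\<^sup>2 / 2) - \<epsilon> * (l * cosh x + (1 - l) * cosh y)"
    show "\<bar>x\<bar> \<le> max r1 r2 \<and> \<bar>y\<bar> \<le> max r1 r2"
    proof (cases "1 / 2 \<le> l")
      case True
      then show ?thesis using half[of l x y] l pos by auto
    next
      case False
      have "0 < N * ((1 - l) * (1 - (1 - l)) * (y - x)\<^sup>2 / 2) - \<epsilon> * ((1 - l) * cosh y + (1 - (1 - l)) * cosh x)"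
        using pos by (simp add: algebra_simps power2_commute)
      then show ?thesis using half[of "1 - l" y x] l False by auto
    qed
  qed
qed

text \<open>Adding \<open>N * x\<^sup>2 / 2\<close> makes the function convex; the last term is the
  gap between this parabola and its own chord.\<close>

lemma chord_bound_second_derivative:
  fixes f :: "real \<Rightarrow> real"
  assumes f: "\<And>y. (f has_real_derivative f' y) (at y)"
    and f': "\<And>y. (f' has_real_derivative f'' y) (at y)"
    and N: "\<And>y. - N \<le> f'' y" and l: "0 \<le> l" "l \<le> 1"
  shows "f (l * x + (1 - l) * y) \<le> l * f x + (1 - l) * f y + N * (l * (1 - l) * (x - y)\<^sup>2 / 2)"
proof -
  have N': "0 \<le> f'' x + N" for x using N[of x] by simp
  have "convex_on UNIV (\<lambda>x. f x + N * x\<^sup>2 / 2)"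
    by (rule f''_ge0_imp_convex[where f' = "\<lambda>x. f' x + N * x" and f'' = "\<lambda>x. f'' x + N"])
      (auto intro!: derivative_eq_intros f f' N')
  from convex_onD[OF this, of "1 - l" x y] l
  have "f (l * x + (1 - l) * y) + N * (l * x + (1 - l) * y)\<^sup>2 / 2
    \<le> l * (f x + N * x\<^sup>2 / 2) + (1 - l) * (f y + N * y\<^sup>2 / 2)" by simp
  moreover have "l * (N * x\<^sup>2 / 2) + (1 - l) * (N * y\<^sup>2 / 2) - N * (l * x + (1 - l) * y)\<^sup>2 / 2
      = N * (l * (1 - l) * (x - y)\<^sup>2 / 2)"
    by (simp add: power2_eq_square field_simps)
  ultimately show ?thesis unfolding distrib_left by linarith
qed

text \<open>Maximum principle for the gap of \<open>D\<close> above its chords: at a maximum, \<open>D\<close> minus the chord has a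
  local maximum at the inner point and local minima at both endpoints. The term \<open>\<epsilon> cosh s\<close>,
  added at the endpoints only, makes the maximum exist.\<close>

lemma convexity_preserved:
  fixes D D' w g :: "real \<Rightarrow> real \<Rightarrow> real"
  assumes cont: "continuous_on (UNIV \<times> {0..T}) (\<lambda>(s,t). D s t)"
    and D1: "\<And>s t. 0 < t \<Longrightarrow> t \<le> T \<Longrightarrow> ((\<lambda>s. D s t) has_real_derivative D' s t) (at s)"
    and D2: "\<And>s t. 0 < t \<Longrightarrow> t \<le> T \<Longrightarrow> ((\<lambda>s. D' s t) has_real_derivative w s t) (at s)"
    and D3: "\<And>s t. 0 < t \<Longrightarrow> t \<le> T \<Longrightarrow> ((\<lambda>t. D s t) has_real_derivative g s t) (at t)"
    and gneg: "\<And>s t. 0 < t \<Longrightarrow> t \<le> T \<Longrightarrow> w s t \<le> 0 \<Longrightarrow> g s t \<le> 0"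
    and glow: "\<And>s t. 0 < t \<Longrightarrow> t \<le> T \<Longrightarrow> - L * max 0 (- w s t) \<le> g s t"
    and wlow: "\<And>s t. 0 < t \<Longrightarrow> t \<le> T \<Longrightarrow> - N \<le> w s t"
    and init: "convex_on UNIV (\<lambda>s. D s 0)"
    and N: "0 \<le> N" and L: "0 \<le> L" and \<tau>: "0 < \<tau>" "\<tau> \<le> T"
  shows "convex_on UNIV (\<lambda>s. D s \<tau>)"
proof (rule ccontr)
  assume "\<not> ?thesis"
  then obtain l0 x0 y0 where l0: "0 < l0" "l0 < 1"
    and viol: "D (l0 * x0 + (1 - l0) * y0) \<tau> > l0 * D x0 \<tau> + (1 - l0) * D y0 \<tau>"
  proof -
    have "\<exists>t x y. 0 < t \<and> t < 1 \<and> D ((1 - t) * x + t * y) \<tau> > (1 - t) * D x \<tau> + t * D y \<tau>"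
      using \<open>\<not> convex_on UNIV (\<lambda>s. D s \<tau>)\<close> convex_onI[of UNIV "\<lambda>s. D s \<tau>"]
      by (force simp: not_le)
    then obtain t x y where "0 < t" "t < 1" "D ((1 - t) * x + t * y) \<tau> > (1 - t) * D x \<tau> + t * D y \<tau>"
      by blast
    then show thesis by (intro that[of "1 - t" x y]) auto
  qed
  \<comment> \<open>As in the barrier argument, the rate \<open>L + 1\<close> in place of
    \<open>L\<close> makes the final inequality strict.\<close>
  define G where "G = (\<lambda>s t. cosh s * exp ((L + 1) * t))"
  have Gpos: "G s t > 0" for s t by (simp add: G_def)
  define A where "A = l0 * G x0 \<tau> + (1 - l0) * G y0 \<tau>"
  have A: "A > 0" unfolding A_def using l0 Gpos by (intro add_pos_pos mult_pos_pos) auto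
  \<comment> \<open>With this \<open>\<epsilon>\<close> the penalty uses up half of the assumed
    violation of convexity.\<close>
  define \<epsilon> where "\<epsilon> = (D (l0 * x0 + (1 - l0) * y0) \<tau> - (l0 * D x0 \<tau> + (1 - l0) * D y0 \<tau>)) / (2 * A)"
  have e: "\<epsilon> > 0" using viol A by (simp add: \<epsilon>_def)
  define E where "E = (\<lambda>s t. D s t + \<epsilon> * G s t)"
  define \<Phi> where "\<Phi> = (\<lambda>x y l t. D (l * x + (1 - l) * y) t - l * E x t - (1 - l) * E y t)"
  have "\<epsilon> * A = (D (l0 * x0 + (1 - l0) * y0) \<tau> - (l0 * D x0 \<tau> + (1 - l0) * D y0 \<tau>)) / 2"
    using A by (simp add: \<epsilon>_def)
  then have \<Phi>0: "\<Phi> x0 y0 l0 \<tau> > 0"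
    using viol by (simp add: \<Phi>_def E_def A_def algebra_simps)
  have Gsum: "0 < l * G x t + (1 - l) * G y t" if "0 \<le> l" "l \<le> 1" for l x y t
  proof (cases "l = 0")
    case False
    then show ?thesis using that Gpos by (intro add_pos_nonneg) (auto simp: less_imp_le)
  qed (use Gpos in auto)
  have init': "\<Phi> x y l 0 < 0" if l: "0 \<le> l" "l \<le> 1" for x y l
  proof -
    have "D (l * x + (1 - l) * y) 0 \<le> l * D x 0 + (1 - l) * D y 0"
      using convex_onD[OF init, of "1 - l" x y] l by simp
    moreover have "0 < \<epsilon> * (l * G x 0 + (1 - l) * G y 0)" using Gsum[OF l] e by simp
    ultimately show ?thesis by (simp add: \<Phi>_def E_def algebra_simps)
  qed
  obtain r where r: "\<And>x y l. 0 \<le> l \<Longrightarrow> l \<le> 1 \<Longrightarrow>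
    0 < N * (l * (1 - l) * (x - y)\<^sup>2 / 2) - \<epsilon> * (l * cosh x + (1 - l) * cosh y) \<Longrightarrow> \<bar>x\<bar> \<le> r \<and> \<bar>y\<bar> \<le> r"
    using cosh_dominates_chord[OF N e] by blast
  have far: "\<bar>x\<bar> \<le> r \<and> \<bar>y\<bar> \<le> r" if l: "0 \<le> l" "l \<le> 1" and t: "0 \<le> t" "t \<le> T" and pos: "\<Phi> x y l t > 0"
    for x y l t
  proof (rule r[OF l])
    have "t > 0" using init'[OF l, of x y] pos t by (cases "t = 0") auto
    have "D (l * x + (1 - l) * y) t \<le> l * D x t + (1 - l) * D y t + N * (l * (1 - l) * (x - y)\<^sup>2 / 2)"
      by (rule chord_bound_second_derivative[where f' = "\<lambda>s. D' s t" and f'' = "\<lambda>s. w s t"])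
        (use D1 D2 wlow \<open>t > 0\<close> t l in auto)
    then have "0 < N * (l * (1 - l) * (x - y)\<^sup>2 / 2) - \<epsilon> * (l * G x t + (1 - l) * G y t)"
      using pos by (simp add: \<Phi>_def E_def algebra_simps)
    moreover have "cosh s \<le> G s t" for s using L t by (simp add: G_def)
    then have "l * cosh x + (1 - l) * cosh y \<le> l * G x t + (1 - l) * G y t"
      using l by (intro add_mono mult_left_mono) auto
    then have "\<epsilon> * (l * cosh x + (1 - l) * cosh y) \<le> \<epsilon> * (l * G x t + (1 - l) * G y t)"
      using e by (intro mult_left_mono) auto
    ultimately show "0 < N * (l * (1 - l) * (x - y)\<^sup>2 / 2) - \<epsilon> * (l * cosh x + (1 - l) * cosh y)"
      by linarith
  qed
  let ?S = "{-r..r} \<times> {-r..r} \<times> {0..1::real} \<times> {0..\<tau>}"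
  have contD: "continuous_on S (\<lambda>p. D (f p) (h p))"
    if "continuous_on S f" "continuous_on S h" "\<And>p. p \<in> S \<Longrightarrow> h p \<in> {0..T}"
    for S :: "(real \<times> real \<times> real \<times> real) set" and f h
    using continuous_on_compose2[OF cont, of S "\<lambda>p. (f p, h p)"] that
    by (fastforce intro!: continuous_on_Pair)
  have cont\<Phi>: "continuous_on ?S (\<lambda>p. \<Phi> (fst p) (fst (snd p)) (fst (snd (snd p))) (snd (snd (snd p))))"
    unfolding \<Phi>_def E_def G_def
    by (intro continuous_intros contD) (use \<tau> in auto)
  have mem: "(x0, y0, l0, \<tau>) \<in> ?S" using far[of l0 \<tau> x0 y0] \<Phi>0 l0 \<tau> by auto
  obtain x y l t where st: "(x, y, l, t) \<in> ?S"
    and max: "\<And>x' y' l' t'. (x', y', l', t') \<in> ?S \<Longrightarrow> \<Phi> x' y' l' t' \<le> \<Phi> x y l t"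
    using continuous_attains_sup[OF _ _ cont\<Phi>] mem
    by (auto simp: compact_Times)
  have \<Phi>1: "\<Phi> x y l t > 0" using max[OF mem] \<Phi>0 by simp
  have l: "0 \<le> l" "l \<le> 1" and t: "0 < t" "t \<le> \<tau>" "t \<le> T"
    using st \<tau> init'[of l x y] \<Phi>1 by (auto simp: less_le)
  have gmax: "\<Phi> x' y' l' t' \<le> \<Phi> x y l t" if "0 \<le> l'" "l' \<le> 1" "0 \<le> t'" "t' \<le> t" for x' y' l' t'
  proof (cases "\<Phi> x' y' l' t' > 0")
    case True
    then show ?thesis using far[of l' t' x' y'] that t by (intro max) auto
  qed (use \<Phi>1 in linarith)
  \<comment> \<open>A degenerate chord has no gap, so \<open>\<Phi>\<close> would be minus a
    positive penalty. The same excludes \<open>l = 0\<close> and \<open>l = 1\<close> below.\<close>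
  have xy: "x \<noteq> y"
  proof
    assume "x = y"
    then have "\<Phi> x y l t = - \<epsilon> * G x t" by (simp add: \<Phi>_def E_def algebra_simps)
    then show False using \<Phi>1 mult_pos_pos[OF e Gpos[of x t]] by simp
  qed
  have "l \<noteq> 0" "l \<noteq> 1"
    using \<Phi>1 mult_pos_pos[OF e Gpos[of x t]] mult_pos_pos[OF e Gpos[of y t]]
    by (auto simp: \<Phi>_def E_def)
  then have l: "0 < l" "l < 1" using l by auto
  \<comment> \<open>Only the endpoint \<open>a\<close> is moved, and the weight is adjusted so that
    the inner point stays fixed. Maximality then puts \<open>E\<close> above the line through its
    values at \<open>a\<close> and \<open>b\<close>, near \<open>a\<close>.\<close>
  have endpoint: "- w a t \<le> \<epsilon> * G a t"
    if ab: "a \<noteq> b" and k: "0 < k" "k < 1" and kmax: "\<And>a' k'. 0 \<le> k' \<Longrightarrow> k' \<le> 1 \<Longrightarrow> \<Phi> a' b k' t \<le> \<Phi> a b k t" for a b k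
  proof -
    define m where "m = (E b t - E a t) / (b - a)"
    have loc: "E a t + m * (a' - a) \<le> E a' t" if "\<bar>a' - a\<bar> < \<bar>b - a\<bar> * (1 - k)" for a'
    proof -
      define \<rho> where "\<rho> = (a' - a) / (b - a)"
      have a': "a' = a + \<rho> * (b - a)" using ab by (simp add: \<rho>_def)
      have "\<bar>\<rho>\<bar> < 1 - k" using that ab by (simp add: \<rho>_def abs_divide field_simps)
      then have \<rho>: "\<rho> < 1 - k" by simp
      \<comment> \<open>This weight keeps the inner point in place after \<open>a\<close> has moved
        by the fraction \<open>\<rho>\<close> of the chord; \<open>\<rho> < 1 - k\<close> keeps it
        below 1.\<close>
      define k' where "k' = k / (1 - \<rho>)"
      have k': "0 < k'" "k' \<le> 1" using \<rho> k by (auto simp: k'_def)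
      have kk: "k' * (1 - \<rho>) = k" using \<rho> k by (simp add: k'_def)
      have "k' * a' + (1 - k') * b = b - (k' * (1 - \<rho>)) * (b - a)"
        by (simp add: a' algebra_simps)
      then have "k' * a' + (1 - k') * b = k * a + (1 - k) * b" unfolding kk by (simp add: algebra_simps)
      then have "k * E a t + (1 - k) * E b t \<le> k' * E a' t + (1 - k') * E b t"
        using kmax[of k' a'] k' by (simp add: \<Phi>_def)
      then have "k' * ((1 - \<rho>) * E a t + \<rho> * E b t) \<le> k' * E a' t"
        unfolding kk[symmetric] by (simp add: algebra_simps)
      then have "(1 - \<rho>) * E a t + \<rho> * E b t \<le> E a' t" using k' by simp
      moreover have "m * (a' - a) = \<rho> * (E b t - E a t)" by (simp add: m_def \<rho>_def)
      ultimately show ?thesis by (simp add: algebra_simps)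
    qed
    have "- (w a t + \<epsilon> * G a t) \<le> 0"
    proof (rule second_derivative_at_max_nonpos)
      show "((\<lambda>s. m * s - E s t) has_real_derivative
          m - (D' s t + \<epsilon> * (sinh s * exp ((L + 1) * t)))) (at s)" for s
        unfolding E_def G_def by (auto intro!: derivative_eq_intros D1 t)
      show "((\<lambda>s. m - (D' s t + \<epsilon> * (sinh s * exp ((L + 1) * t)))) has_real_derivative
          - (w a t + \<epsilon> * G a t)) (at a)"
        unfolding G_def by (auto intro!: derivative_eq_intros D2 t)
      show "0 < \<bar>b - a\<bar> * (1 - k)" using ab k by auto
      show "m * a' - E a' t \<le> m * a - E a t" if "\<bar>a' - a\<bar> < \<bar>b - a\<bar> * (1 - k)" for a'
        using loc[OF that] by (simp add: algebra_simps)
    qed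
    then show ?thesis by simp
  qed
  have wx: "- w x t \<le> \<epsilon> * G x t"
    by (rule endpoint[OF xy l]) (use gmax t in auto)
  have wy: "- w y t \<le> \<epsilon> * G y t"
  proof (rule endpoint)
    have sym: "\<Phi> a b k t = \<Phi> b a (1 - k) t" for a b k by (simp add: \<Phi>_def add.commute)
    show "\<Phi> a' x k' t \<le> \<Phi> y x (1 - l) t" if "0 \<le> k'" "k' \<le> 1" for a' k'
      using gmax[of "1 - k'" t x a'] sym[of a' x k'] sym[of y x "1 - l"] that t by simp
  qed (use xy l in auto)
  define z where "z = l * x + (1 - l) * y"
  have wz: "w z t \<le> 0"
  proof -
    define m where "m = (E y t - E x t) / (y - x)"
    \<comment> \<open>Here both endpoints are fixed and only the weight varies, which moves the
      inner point along the chord of slope \<open>m\<close>.\<close>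
    have loc: "D z' t - m * z' \<le> D z t - m * z" if "\<bar>z' - z\<bar> < \<bar>y - x\<bar> * min l (1 - l)" for z'
    proof -
      define \<rho> where "\<rho> = (z' - z) / (y - x)"
      have z': "z' = z + \<rho> * (y - x)" using xy by (simp add: \<rho>_def)
      have "\<bar>y - x\<bar> * \<bar>\<rho>\<bar> < \<bar>y - x\<bar> * min l (1 - l)" using that xy by (simp add: \<rho>_def abs_divide)
      then have "\<bar>\<rho>\<bar> < min l (1 - l)" by (rule mult_left_less_imp_less) simp
      then have "\<Phi> x y (l - \<rho>) t \<le> \<Phi> x y l t" by (intro gmax) (use t in auto)
      moreover have zz: "(l - \<rho>) * x + (1 - (l - \<rho>)) * y = z'" by (simp add: z' z_def algebra_simps)
      ultimately have "D z' t - (l - \<rho>) * E x t - (1 - (l - \<rho>)) * E y t \<le> D z t - l * E x t - (1 - l) * E y t"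
        unfolding \<Phi>_def zz z_def[symmetric] by simp
      then have "D z' t - \<rho> * (E y t - E x t) \<le> D z t" by (simp add: algebra_simps)
      moreover have "m * (z' - z) = \<rho> * (E y t - E x t)" by (simp add: m_def \<rho>_def)
      ultimately show ?thesis by (simp add: algebra_simps)
    qed
    show ?thesis
    proof (rule second_derivative_at_max_nonpos)
      show "((\<lambda>s. D s t - m * s) has_real_derivative D' s t - m) (at s)" for s
        by (auto intro!: derivative_eq_intros D1 t)
      show "((\<lambda>s. D' s t - m) has_real_derivative w z t) (at z)"
        by (auto intro!: derivative_eq_intros D2 t)
      show "0 < \<bar>y - x\<bar> * min l (1 - l)" using xy l by auto
    qed (rule loc)
  qed
  have gE: "0 < g a t + \<epsilon> * ((L + 1) * G a t)" if "- w a t \<le> \<epsilon> * G a t" for a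
  proof -
    have "L * max 0 (- w a t) \<le> L * (\<epsilon> * G a t)"
      using that mult_pos_pos[OF e Gpos[of a t]] L by (intro mult_left_mono) auto
    then show ?thesis using glow[of t a] t mult_pos_pos[OF e Gpos[of a t]] by (simp add: algebra_simps)
  qed
  \<comment> \<open>The time derivative of \<open>\<Phi>\<close> is nonnegative at its maximum, yet
    the inner term is at most 0 and both endpoint terms are subtracted with positive values.\<close>
  have "0 \<le> g z t - l * (g x t + \<epsilon> * ((L + 1) * G x t)) - (1 - l) * (g y t + \<epsilon> * ((L + 1) * G y t))"
  proof (rule derivative_at_left_max_nonneg)
    show "((\<lambda>t. \<Phi> x y l t) has_real_derivative
      g z t - l * (g x t + \<epsilon> * ((L + 1) * G x t)) - (1 - l) * (g y t + \<epsilon> * ((L + 1) * G y t))) (at t)"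
      unfolding \<Phi>_def E_def G_def z_def[symmetric]
      by (auto intro!: derivative_eq_intros D3 t simp: algebra_simps)
    show "\<Phi> x y l t' \<le> \<Phi> x y l t" if "0 \<le> t'" "t' \<le> t" for t' using gmax that l by auto
  qed (rule t)
  moreover have "g z t \<le> 0" using gneg wz t by auto
  moreover have "0 < l * (g x t + \<epsilon> * ((L + 1) * G x t))" "0 < (1 - l) * (g y t + \<epsilon> * ((L + 1) * G y t))"
    using gE[OF wx] gE[OF wy] l by simp_all
  ultimately show False by linarith
qed

section \<open>Second primitives of solutions\<close>

text \<open>\<open>Q\<close> is a second primitive of \<open>v\<close> in \<open>s\<close>, with \<open>Q' = Q\<^sub>s\<close>.\<close>

definition potential ::
  "real \<Rightarrow> (real \<Rightarrow> real \<Rightarrow> real) \<Rightarrow> (real \<Rightarrow> real \<Rightarrow> real) \<Rightarrow> (real \<Rightarrow> real \<Rightarrow> real) \<Rightarrow> bool" where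
  "potential m v Q Q' \<longleftrightarrow>
     continuous_on (UNIV \<times> {0..}) (\<lambda>(s,t). Q s t) \<and>
     (\<forall>T. \<exists>B. \<forall>s. \<forall>t\<in>{0<..T}. v s t \<le> B) \<and>
     (\<forall>s. \<forall>t>0. 0 \<le> v s t \<and>
        ((\<lambda>s. Q s t) has_real_derivative Q' s t) (at s) \<and>
        ((\<lambda>s. Q' s t) has_real_derivative v s t) (at s) \<and>
        ((\<lambda>t. Q s t) has_real_derivative v s t powr m) (at t))"

lemma potentialD:
  assumes "potential m v Q Q'"
  shows "continuous_on (UNIV \<times> {0..}) (\<lambda>(s,t). Q s t)"
    and "\<exists>B. \<forall>s. \<forall>t\<in>{0<..T}. v s t \<le> B"
    and "0 < t \<Longrightarrow> 0 \<le> v s t"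
    and "0 < t \<Longrightarrow> ((\<lambda>s. Q s t) has_real_derivative Q' s t) (at s)"
    and "0 < t \<Longrightarrow> ((\<lambda>s. Q' s t) has_real_derivative v s t) (at s)"
    and "0 < t \<Longrightarrow> ((\<lambda>t. Q s t) has_real_derivative v s t powr m) (at t)"
  using assms unfolding potential_def by blast+

lemma potential_continuous_diff:
  assumes "potential m v Q Q'" "potential m V R R'"
  shows "continuous_on (UNIV \<times> {0..T}) (\<lambda>(s,t). R s t - Q s t)"
proof -
  have "continuous_on (UNIV \<times> {0..}) (\<lambda>p. R (fst p) (snd p) - Q (fst p) (snd p))"
    using potentialD(1)[OF assms(1)] potentialD(1)[OF assms(2)]
    unfolding split_beta by (rule continuous_on_diff[rotated])
  then show ?thesis unfolding split_beta by (rule continuous_on_subset) auto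
qed

section \<open>Comparison and barriers for pairs of solutions\<close>

text \<open>Mean value theorem for the power, with its increasing derivative evaluated at
  \<open>B\<close>. It supplies the constant \<open>L\<close> of the maximum principles for
  differences of potentials.\<close>

lemma powr_diff_le:
  fixes a b m B :: real
  assumes m: "m > 1" and a: "0 \<le> a" "a \<le> B" and b: "0 \<le> b" "b \<le> B"
  shows "a powr m - b powr m \<le> m * B powr (m - 1) * max 0 (a - b)"
proof (cases "a \<le> b")
  case True
  then show ?thesis using a m by (auto intro: powr_mono2)
next
  case False
  have "\<exists>z>b. z < a \<and> a powr m - b powr m = (a - b) * (m * z powr (m - 1))"
  proof -
    have "continuous_on {b..a} (\<lambda>x. x powr m)"
      by (intro continuous_on_powr' continuous_intros) (use b m in auto)
    moreover have "((\<lambda>x. x powr m) has_real_derivative m * x powr (m - 1)) (at x)" if "b < x" for x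
      using that b by (auto intro!: derivative_eq_intros)
    ultimately show ?thesis
      using MVT[of b a "\<lambda>x. x powr m"] False
      by (metis DERIV_unique not_le real_differentiable_def)
  qed
  then obtain z where z: "b < z" "z < a" "a powr m - b powr m = (a - b) * (m * z powr (m - 1))"
    by blast
  have "z powr (m - 1) \<le> B powr (m - 1)" using z a b m by (intro powr_mono2) auto
  then have "(a - b) * (m * z powr (m - 1)) \<le> (a - b) * (m * B powr (m - 1))"
    using False m by (intro mult_left_mono) auto
  then show ?thesis using z False by (simp add: mult.commute)
qed

text \<open>A convex function lies above its tangent, so tangent minus function has a maximum at the
  point of contact.\<close>

lemma convex_twice_differentiable_nonneg:
  fixes f :: "real \<Rightarrow> real"
  assumes conv: "convex_on UNIV f"
    and f: "\<And>y. (f has_real_derivative f' y) (at y)"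
    and f': "(f' has_real_derivative c) (at x)"
  shows "0 \<le> c"
proof -
  have "- c \<le> 0"
  proof (rule second_derivative_at_max_nonpos)
    show "((\<lambda>y. f' x * y - f y) has_real_derivative f' x - f' y) (at y)" for y
      by (auto intro!: derivative_eq_intros f)
    show "((\<lambda>y. f' x - f' y) has_real_derivative - c) (at x)"
      by (auto intro!: derivative_eq_intros f')
    show "f' x * y - f y \<le> f' x * x - f x" for y
      using convex_on_imp_above_tangent[OF conv, of x y "f' x"] f[of x]
      by (simp add: algebra_simps)
  qed (rule zero_less_one)
  then show ?thesis by simp
qed

text \<open>The order of the initial data is expressed as convexity of \<open>R - Q\<close> at time
  0. The second space derivative of this difference is \<open>V - v\<close> and its time derivative
  has the same sign, so convexity persists and gives the order at time \<open>t\<close>.\<close>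

lemma potential_comparison:
  assumes m: "m > 1" and Q: "potential m v Q Q'" and R: "potential m V R R'"
    and init: "convex_on UNIV (\<lambda>s. R s 0 - Q s 0)" and t: "t > 0"
  shows "v s t \<le> V s t"
proof -
  obtain B1 B2 where B1: "\<And>s \<tau>. 0 < \<tau> \<Longrightarrow> \<tau> \<le> t \<Longrightarrow> v s \<tau> \<le> B1"
    and B2: "\<And>s \<tau>. 0 < \<tau> \<Longrightarrow> \<tau> \<le> t \<Longrightarrow> V s \<tau> \<le> B2"
    using potentialD(2)[OF Q, of t] potentialD(2)[OF R, of t]
    by (metis greaterThanAtMost_iff)
  define B where "B = max B1 B2"
  have vB: "0 \<le> v s \<tau>" "v s \<tau> \<le> B" "0 \<le> V s \<tau>" "V s \<tau> \<le> B" if "0 < \<tau>" "\<tau> \<le> t" for s \<tau>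
    using B1[OF that, of s] B2[OF that, of s] potentialD(3)[OF Q] potentialD(3)[OF R] that
    by (auto simp: B_def)
  have B: "0 \<le> B" using vB(1,2)[of t 0] t by simp
  have "convex_on UNIV (\<lambda>s. R s t - Q s t)"
  proof (rule convexity_preserved[where D' = "\<lambda>s t. R' s t - Q' s t" and w = "\<lambda>s t. V s t - v s t"
        and g = "\<lambda>s t. V s t powr m - v s t powr m" and T = t and N = B
        and L = "m * B powr (m - 1)"])
    show "continuous_on (UNIV \<times> {0..t}) (\<lambda>(s, t). R s t - Q s t)"
      by (rule potential_continuous_diff[OF Q R])
    fix s \<tau> assume \<tau>: "0 < \<tau>" "\<tau> \<le> t"
    show "((\<lambda>s. R s \<tau> - Q s \<tau>) has_real_derivative R' s \<tau> - Q' s \<tau>) (at s)"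
      "((\<lambda>s. R' s \<tau> - Q' s \<tau>) has_real_derivative V s \<tau> - v s \<tau>) (at s)"
      "((\<lambda>t. R s t - Q s t) has_real_derivative V s \<tau> powr m - v s \<tau> powr m) (at \<tau>)"
      using potentialD(4-6)[OF Q \<tau>(1)] potentialD(4-6)[OF R \<tau>(1)]
      by (auto intro!: derivative_eq_intros)
    show "V s \<tau> powr m - v s \<tau> powr m \<le> 0" if "V s \<tau> - v s \<tau> \<le> 0"
      using that vB[OF \<tau>, of s] m by (auto intro!: powr_mono2)
    show "- (m * B powr (m - 1)) * max 0 (- (V s \<tau> - v s \<tau>)) \<le> V s \<tau> powr m - v s \<tau> powr m"
      using powr_diff_le[OF m, of "v s \<tau>" B "V s \<tau>"] vB[OF \<tau>, of s] by simp
    show "- B \<le> V s \<tau> - v s \<tau>" using vB[OF \<tau>, of s] by simp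
  qed (use init t B m in auto)
  then have "0 \<le> V s t - v s t"
    by (rule convex_twice_differentiable_nonneg[where f' = "\<lambda>s. R' s t - Q' s t"])
      (use potentialD(4,5)[OF Q t] potentialD(4,5)[OF R t] in \<open>auto intro!: derivative_eq_intros\<close>)
  then show ?thesis by simp
qed

text \<open>The time derivative of \<open>Q\<close> is \<open>v powr m\<close>, which lies between 0
  and \<open>M powr m\<close>; continuity down to time 0 lets the mean value theorem start
  there.\<close>

lemma potential_increment:
  assumes m: "m > 1" and Q: "potential m v Q Q'"
    and M: "\<And>s t. t > 0 \<Longrightarrow> v s t \<le> M" and t: "0 \<le> t"
  shows "Q s 0 \<le> Q s t" "Q s t \<le> Q s 0 + M powr m * t"
proof -
  have "Q s 0 \<le> Q s t \<and> Q s t \<le> Q s 0 + M powr m * t"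
  proof (cases "t = 0")
    case False
    have "continuous_on {0..t} (\<lambda>\<tau>. Q s \<tau>)"
      using continuous_on_compose2[OF potentialD(1)[OF Q], of "{0..t}" "\<lambda>\<tau>. (s, \<tau>)"]
      by (fastforce intro!: continuous_on_Pair continuous_on_const continuous_on_id)
    moreover have d: "(Q s has_real_derivative v s x powr m) (at x)" if "0 < x" for x
      using potentialD(6)[OF Q] that by simp
    ultimately obtain z where z: "0 < z" "z < t" "Q s t - Q s 0 = t * (v s z powr m)"
      using MVT[of 0 t "Q s"] False t
      by (metis DERIV_unique diff_zero order.order_iff_strict real_differentiable_def)
    have "v s z powr m \<le> M powr m"
      using M[of z s] z m potentialD(3)[OF Q, of z s] by (intro powr_mono2) auto
    then have "t * (v s z powr m) \<le> t * M powr m" using t by (intro mult_left_mono) auto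
    moreover have "0 \<le> t * (v s z powr m)" using t by simp
    ultimately show ?thesis using z(3) mult.commute[of "M powr m" t] by linarith
  qed auto
  then show "Q s 0 \<le> Q s t" "Q s t \<le> Q s 0 + M powr m * t" by auto
qed

text \<open>An affine function of \<open>s\<close> changes neither \<open>V - v\<close> nor the time
  derivative, so it may be subtracted before the barrier is applied. Its coefficients are free
  because a second primitive is determined only up to such functions.\<close>

lemma potential_barrier:
  assumes m: "m > 1" and Q: "potential m v Q Q'" and R: "potential m V R R'"
    and vM: "\<And>s t. t > 0 \<Longrightarrow> v s t \<le> M" and VM: "\<And>s t. t > 0 \<Longrightarrow> V s t \<le> M"
    and init: "\<And>s. \<bar>R s 0 - Q s 0 - (\<alpha> + \<beta> * (s - s0))\<bar> \<le> b * cosh (\<theta> * (s - s0)) + C"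
    and b: "0 \<le> b" and \<theta>: "\<theta> > 0" and t: "0 \<le> t"
  shows "\<bar>R s t - Q s t - (\<alpha> + \<beta> * (s - s0))\<bar>
    \<le> b * cosh (\<theta> * (s - s0)) * exp ((m * M powr (m - 1) + 1) * \<theta>\<^sup>2 * t) + C"
proof -
  \<comment> \<open>The upper estimate is stated for arbitrary pairs, so that exchanging the
    solutions and negating \<open>\<alpha>\<close>, \<open>\<beta>\<close> yields the lower one. The
    a priori constant \<open>C'\<close> exceeds \<open>C\<close> by the largest possible increment
    of \<open>R\<close> in time.\<close>
  have half: "R s t - Q s t - (\<alpha> + \<beta> * (s - s0))
      \<le> b * cosh (\<theta> * (s - s0)) * exp ((m * M powr (m - 1) + 1) * \<theta>\<^sup>2 * t) + C"
    if Q: "potential m v Q Q'" and R: "potential m V R R'"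
      and vM: "\<And>s t. t > 0 \<Longrightarrow> v s t \<le> M" and VM: "\<And>s t. t > 0 \<Longrightarrow> V s t \<le> M"
      and init: "\<And>s. R s 0 - Q s 0 - (\<alpha> + \<beta> * (s - s0)) \<le> b * cosh (\<theta> * (s - s0)) + C"
    for v Q Q' V R R' \<alpha> \<beta>
  proof (rule barrier_principle[where D' = "\<lambda>s t. R' s t - Q' s t - \<beta>" and w = "\<lambda>s t. V s t - v s t"
        and g = "\<lambda>s t. V s t powr m - v s t powr m" and T = t and C' = "C + M powr m * t"])
    show "continuous_on (UNIV \<times> {0..t}) (\<lambda>(s, t). R s t - Q s t - (\<alpha> + \<beta> * (s - s0)))"
      using continuous_on_diff[OF potential_continuous_diff[OF Q R, of t],
          of "\<lambda>p. \<alpha> + \<beta> * (fst p - s0)"]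
      unfolding split_beta by (simp add: continuous_intros)
    show "R s 0 - Q s 0 - (\<alpha> + \<beta> * (s - s0)) \<le> b * cosh (\<theta> * (s - s0)) + C" for s by (rule init)
    fix s \<tau> assume \<tau>: "0 < \<tau>" "\<tau> \<le> t"
    show "((\<lambda>s. R s \<tau> - Q s \<tau> - (\<alpha> + \<beta> * (s - s0))) has_real_derivative R' s \<tau> - Q' s \<tau> - \<beta>) (at s)"
      "((\<lambda>s. R' s \<tau> - Q' s \<tau> - \<beta>) has_real_derivative V s \<tau> - v s \<tau>) (at s)"
      "((\<lambda>t. R s t - Q s t - (\<alpha> + \<beta> * (s - s0))) has_real_derivative V s \<tau> powr m - v s \<tau> powr m) (at \<tau>)"
      using potentialD(4-6)[OF Q \<tau>(1)] potentialD(4-6)[OF R \<tau>(1)]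
      by (auto intro!: derivative_eq_intros)
    show "V s \<tau> powr m - v s \<tau> powr m \<le> (m * M powr (m - 1)) * max 0 (V s \<tau> - v s \<tau>)"
      using powr_diff_le[OF m, of "V s \<tau>" M "v s \<tau>"] vM VM \<tau> potentialD(3)[OF Q] potentialD(3)[OF R]
      by simp
    have "M powr m * \<tau> \<le> M powr m * t" using \<tau> by (intro mult_left_mono) auto
    then show "R s \<tau> - Q s \<tau> - (\<alpha> + \<beta> * (s - s0)) \<le> b * cosh (\<theta> * (s - s0)) + (C + M powr m * t)"
      using potential_increment(2)[OF m R VM, of \<tau> s] potential_increment(1)[OF m Q vM, of \<tau> s] \<tau> init[of s]
      by simp
  qed (use b \<theta> t m in auto)
  have "Q s t - R s t - (- \<alpha> + (- \<beta>) * (s - s0))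
      \<le> b * cosh (\<theta> * (s - s0)) * exp ((m * M powr (m - 1) + 1) * \<theta>\<^sup>2 * t) + C"
  proof (rule half[OF R Q VM vM])
    show "Q s 0 - R s 0 - (- \<alpha> + - \<beta> * (s - s0)) \<le> b * cosh (\<theta> * (s - s0)) + C" for s
      using init[of s] by simp
  qed
  moreover have "R s t - Q s t - (\<alpha> + \<beta> * (s - s0))
      \<le> b * cosh (\<theta> * (s - s0)) * exp ((m * M powr (m - 1) + 1) * \<theta>\<^sup>2 * t) + C"
  proof (rule half[OF Q R vM VM])
    show "R s 0 - Q s 0 - (\<alpha> + \<beta> * (s - s0)) \<le> b * cosh (\<theta> * (s - s0)) + C" for s
      using init[of s] by simp
  qed
  ultimately show ?thesis by simp
qed

section \<open>Scaling, time monotonicity and semiconvexity\<close>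

text \<open>The scaling group of the porous medium equation: \<open>rel\<close> balances the factor
  \<open>\<kappa> * \<mu>\<close> of the time derivative against
  \<open>\<kappa> powr m * a\<^sup>2\<close> of the diffusion term. The potential carries
  \<open>1 / a\<^sup>2\<close> because it is a second primitive in space.\<close>

lemma potential_rescale:
  assumes Q: "potential m v Q Q'" and p: "0 < \<kappa>" "0 < a" "0 < \<mu>"
    and rel: "\<kappa> powr m * a\<^sup>2 = \<kappa> * \<mu>"
  shows "potential m (\<lambda>s t. \<kappa> * v (a * s) (\<mu> * t))
    (\<lambda>s t. \<kappa> / a\<^sup>2 * Q (a * s) (\<mu> * t)) (\<lambda>s t. \<kappa> / a * Q' (a * s) (\<mu> * t))"
  unfolding potential_def
proof (intro conjI allI impI)
  have "continuous_on (UNIV \<times> {0..}) (\<lambda>p. Q (a * fst p) (\<mu> * snd p))"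
    using continuous_on_compose2[OF potentialD(1)[OF Q], of "UNIV \<times> {0..}" "\<lambda>p. (a * fst p, \<mu> * snd p)"] p
    by (fastforce intro!: continuous_intros)
  then show "continuous_on (UNIV \<times> {0..}) (\<lambda>(s, t). \<kappa> / a\<^sup>2 * Q (a * s) (\<mu> * t))"
    unfolding split_beta by (intro continuous_intros)
next
  fix T
  obtain B where "\<And>s t. t \<in> {0<..\<mu> * T} \<Longrightarrow> v s t \<le> B" using potentialD(2)[OF Q] by blast
  then have "\<kappa> * v (a * s) (\<mu> * t) \<le> \<kappa> * B" if "t \<in> {0<..T}" for s t
    using that p by (intro mult_left_mono) auto
  then show "\<exists>B. \<forall>s. \<forall>t\<in>{0<..T}. \<kappa> * v (a * s) (\<mu> * t) \<le> B" by blast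
next
  fix s t :: real assume t: "0 < t"
  then have t': "0 < \<mu> * t" using p by simp
  note q = potentialD(3-6)[OF Q t']
  show "0 \<le> \<kappa> * v (a * s) (\<mu> * t)" using q(1) p by simp
  have "((\<lambda>s. Q (a * s) (\<mu> * t)) has_real_derivative Q' (a * s) (\<mu> * t) * a) (at s)"
    by (rule DERIV_chain2[OF q(2)]) (auto intro!: derivative_eq_intros)
  from DERIV_cmult[OF this, of "\<kappa> / a\<^sup>2"]
  show "((\<lambda>s. \<kappa> / a\<^sup>2 * Q (a * s) (\<mu> * t)) has_real_derivative \<kappa> / a * Q' (a * s) (\<mu> * t)) (at s)"
    using p by (simp add: power2_eq_square field_simps)
  have "((\<lambda>s. Q' (a * s) (\<mu> * t)) has_real_derivative v (a * s) (\<mu> * t) * a) (at s)"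
    by (rule DERIV_chain2[OF q(3)]) (auto intro!: derivative_eq_intros)
  from DERIV_cmult[OF this, of "\<kappa> / a"]
  show "((\<lambda>s. \<kappa> / a * Q' (a * s) (\<mu> * t)) has_real_derivative \<kappa> * v (a * s) (\<mu> * t)) (at s)"
    using p by (simp add: field_simps)
  have "(Q (a * s) has_real_derivative v (a * s) (\<mu> * t) powr m) (at (\<mu> * t))" by (rule q(4))
  then have "((\<lambda>t. Q (a * s) (\<mu> * t)) has_real_derivative v (a * s) (\<mu> * t) powr m * \<mu>) (at t)"
    by (rule DERIV_chain2) (auto intro!: derivative_eq_intros)
  from DERIV_cmult[OF this, of "\<kappa> / a\<^sup>2"]
  have "((\<lambda>t. \<kappa> / a\<^sup>2 * Q (a * s) (\<mu> * t)) has_real_derivative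
      \<kappa> * \<mu> / a\<^sup>2 * v (a * s) (\<mu> * t) powr m) (at t)" by (simp add: mult_ac)
  moreover have "\<kappa> * \<mu> / a\<^sup>2 = \<kappa> powr m" unfolding rel[symmetric] using p by simp
  ultimately show "((\<lambda>t. \<kappa> / a\<^sup>2 * Q (a * s) (\<mu> * t)) has_real_derivative
      (\<kappa> * v (a * s) (\<mu> * t)) powr m) (at t)"
    using q(1)[of "a * s"] p by (simp add: powr_mult)
qed

lemma potential_constant:
  assumes "0 \<le> c"
  shows "potential m (\<lambda>s t. c) (\<lambda>s t. c * s\<^sup>2 / 2 + c powr m * t) (\<lambda>s t. c * s)"
  unfolding potential_def split_beta
  by (auto intro!: derivative_eq_intros continuous_intros assms)

text \<open>The rescaled function \<open>\<kappa> v(s, \<kappa>\<^bsup>m-1\<^esup> t)\<close> is again a solution and has larger data,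
  so comparison applies.\<close>

lemma potential_time_monotone:
  assumes m: "m > 1" and Q: "potential m v Q Q'" and conv: "convex_on UNIV (\<lambda>s. Q s 0)"
    and t: "0 < t1" "t1 \<le> t2"
  shows "v s t1 \<le> (t2 / t1) powr (1 / (m - 1)) * v s t2"
proof -
  \<comment> \<open>With the space variable unscaled, this \<open>\<kappa>\<close> makes the
    rescaled solution at time \<open>t1\<close> a multiple of the original at time
    \<open>t2\<close>.\<close>
  define \<kappa> where "\<kappa> = (t2 / t1) powr (1 / (m - 1))"
  have k: "\<kappa> \<ge> 1" unfolding \<kappa>_def using t m by (intro ge_one_powr_ge_zero) auto
  have km: "\<kappa> powr (m - 1) = t2 / t1" using t m by (simp add: \<kappa>_def powr_powr)
  have "\<kappa> powr m = \<kappa> * \<kappa> powr (m - 1)" using powr_mult_base[of \<kappa> "m - 1"] k by simp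
  then have rel: "\<kappa> powr m * 1\<^sup>2 = \<kappa> * (t2 / t1)" using k km by simp
  have "0 < \<kappa>" "0 < t2 / t1" using k t by auto
  note R = potential_rescale[OF Q this(1) zero_less_one this(2) rel]
  have "convex_on UNIV (\<lambda>s. \<kappa> / 1\<^sup>2 * Q (1 * s) (t2 / t1 * 0) - Q s 0)"
    using convex_on_cmul[OF _ conv, of "\<kappa> - 1"] k by (simp add: algebra_simps)
  from potential_comparison[OF m Q R this t(1), of s] t
  show ?thesis by (simp add: \<kappa>_def)
qed

text \<open>Comparison with the constant solution \<open>M\<close>; the initial difference of
  potentials has second derivative \<open>M - v0\<close>, hence is convex.\<close>

lemma potential_le_bound:
  assumes m: "m > 1" and Q: "potential m v Q Q'"
    and Q1: "\<And>s. ((\<lambda>s. Q s 0) has_real_derivative Q0' s) (at s)"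
    and Q2: "\<And>s. (Q0' has_real_derivative v0 s) (at s)"
    and M: "\<And>s. v0 s \<le> M" "0 \<le> M" and t: "0 < t"
  shows "v s t \<le> M"
proof (rule potential_comparison[OF m Q potential_constant[OF M(2)] _ t])
  show "convex_on UNIV (\<lambda>s. M * s\<^sup>2 / 2 + M powr m * 0 - Q s 0)"
    by (rule f''_ge0_imp_convex[where f' = "\<lambda>s. M * s - Q0' s" and f'' = "\<lambda>s. M - v0 s"])
      (use M in \<open>auto intro!: derivative_eq_intros Q1 Q2\<close>)
qed

text \<open>Writing \<open>x powr m\<close> as \<open>x * x powr (m - 1)\<close>, both second
  factors are replaced by the larger \<open>a powr (m - 1)\<close>. It turns a modulus of continuity
  for the power into one for the function.\<close>

lemma powr_superadditive:
  fixes a b m :: real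
  assumes "1 \<le> m" "0 \<le> b" "b \<le> a"
  shows "(a - b) powr m \<le> a powr m - b powr m"
proof -
  have *: "x powr m = x * x powr (m - 1)" if "0 \<le> x" for x :: real
    using that powr_mult_base[of x "m - 1"] by simp
  have "(a - b) * (a - b) powr (m - 1) + b * b powr (m - 1)
      \<le> (a - b) * a powr (m - 1) + b * a powr (m - 1)"
    using assms by (intro add_mono mult_left_mono powr_mono2) auto
  then show ?thesis using *[of "a - b"] *[of b] *[of a] assms by (simp add: algebra_simps)
qed

text \<open>Time monotonicity bounds \<open>(v\<^sup>m)\<^sub>s\<^sub>s = v\<^sub>t\<close> from below by \<open>- M / ((m - 1) t)\<close>.\<close>

lemma potential_semiconvex:
  assumes m: "m > 1" and Q: "potential m v Q Q'" and conv: "convex_on UNIV (\<lambda>s. Q s 0)"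
    and M: "\<And>s t. 0 < t \<Longrightarrow> v s t \<le> M" and t: "0 < t" and l: "0 \<le> l" "l \<le> 1"
  shows "v (l * x + (1 - l) * y) t powr m \<le> l * v x t powr m + (1 - l) * v y t powr m
    + M / ((m - 1) * t) * (l * (1 - l) * (x - y)\<^sup>2 / 2)"
proof -
  define c where "c = M / ((m - 1) * t)"
  define z where "z = l * x + (1 - l) * y"
  \<comment> \<open>Time monotonicity limits the relative drop of \<open>v\<close> to
    \<open>1 - 1 / q\<close>, and two elementary logarithm and exponential inequalities make this
    linear in \<open>t2 - t\<close>.\<close>
  have low: "- (c * (t2 - t)) \<le> v s t2 - v s t" if "t \<le> t2" for s t2
  proof -
    define q where "q = (t2 / t) powr (1 / (m - 1))"
    have q: "q > 0" using t that by (simp add: q_def)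
    have "1 - (t2 - t) / ((m - 1) * t) \<le> 1 - ln (t2 / t) / (m - 1)"
      using ln_le_minus_one[of "t2 / t"] t that m by (simp add: divide_simps) (simp add: algebra_simps)
    also have "\<dots> \<le> exp (- (ln (t2 / t) / (m - 1)))"
      using exp_ge_add_one_self[of "- (ln (t2 / t) / (m - 1))"] by simp
    also have "\<dots> = 1 / q" using t that by (simp add: q_def powr_def exp_minus field_simps)
    finally have *: "1 - 1 / q \<le> (t2 - t) / ((m - 1) * t)" by simp
    have v: "v s t \<le> q * v s t2" using potential_time_monotone[OF m Q conv t that] by (simp add: q_def)
    have "v s t - v s t2 \<le> v s t * (1 - 1 / q)" using v q by (simp add: field_simps)
    also have "\<dots> \<le> v s t * ((t2 - t) / ((m - 1) * t))"
      using * potentialD(3)[OF Q t] by (intro mult_left_mono) auto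
    also have "\<dots> \<le> M * ((t2 - t) / ((m - 1) * t))"
      using M[OF t] that t m by (intro mult_right_mono) auto
    finally show ?thesis by (simp add: c_def)
  qed
  define W where "W = l * (1 - l) * (x - y)\<^sup>2 / 2"
  \<comment> \<open>No time derivative of \<open>v\<close> is assumed. The chord bound is applied to
    the increment of \<open>Q\<close> between \<open>t\<close> and \<open>t2\<close>, and
    differentiating in \<open>t2\<close> at \<open>t\<close> produces the powers
    \<open>v powr m\<close>.\<close>
  define J where "J = (\<lambda>\<tau>. Q z \<tau> - l * Q x \<tau> - (1 - l) * Q y \<tau> - c * W * \<tau>)"
  have J: "J t2 \<le> J t" if "t \<le> t2" for t2
  proof -
    have t2: "0 < t2" using that t by simp
    have "Q z t2 - Q z t \<le> l * (Q x t2 - Q x t) + (1 - l) * (Q y t2 - Q y t)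
        + (c * (t2 - t)) * W"
      unfolding z_def W_def
      by (rule chord_bound_second_derivative[where f' = "\<lambda>s. Q' s t2 - Q' s t" and f'' = "\<lambda>s. v s t2 - v s t"])
        (use low[OF that] l potentialD(4,5)[OF Q t] potentialD(4,5)[OF Q t2] in
          \<open>auto intro!: derivative_eq_intros\<close>)
    then show ?thesis by (simp add: J_def algebra_simps)
  qed
  \<comment> \<open>\<open>J\<close> is largest at \<open>t\<close> among later times; the
    reflection \<open>2 * t - \<tau>\<close> turns them into earlier ones.\<close>
  have "0 \<le> - (v z t powr m - l * v x t powr m - (1 - l) * v y t powr m - c * W)"
  proof (rule derivative_at_left_max_nonneg[where f = "\<lambda>\<tau>. J (2 * t - \<tau>)" and t = t and a = "t - 1"])
    have d: "(Q s has_real_derivative v s t powr m) (at (2 * t - t))" for s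
      using potentialD(6)[OF Q t, of s] by simp
    have d': "((\<lambda>\<tau>. Q s (2 * t - \<tau>)) has_real_derivative v s t powr m * (- 1)) (at t)" for s
      by (rule DERIV_chain2[where f = "Q s" and g = "\<lambda>\<tau>. 2 * t - \<tau>", OF d])
        (auto intro!: derivative_eq_intros)
    show "((\<lambda>\<tau>. J (2 * t - \<tau>)) has_real_derivative
       - (v z t powr m - l * v x t powr m - (1 - l) * v y t powr m - c * W)) (at t)"
      unfolding J_def by (auto intro!: derivative_eq_intros d')
  qed (use J t in auto)
  then show ?thesis by (simp add: z_def c_def W_def)
qed

text \<open>On a segment of length \<open>sqrt t\<close> the semiconvexity error is of order
  \<open>t * (1 / t)\<close>, hence bounded. Interpolating between a point and one at distance
  \<open>sqrt t\<close>, where only the bound \<open>M\<close> is used, makes the increase of the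
  power at most proportional to the relative distance.\<close>

lemma potential_equicontinuous:
  assumes m: "m > 1" and Q: "potential m v Q Q'" and conv: "convex_on UNIV (\<lambda>s. Q s 0)"
    and M: "\<And>s t. 0 < t \<Longrightarrow> v s t \<le> M" and t: "0 < t" and \<mu>: "0 \<le> \<mu>" "\<mu> \<le> 1"
    and near: "\<bar>s' - s\<bar> \<le> \<mu> * sqrt t"
  shows "\<bar>v s' t - v s t\<bar> powr m \<le> \<mu> * (M powr m + M / (m - 1))"
proof -
  have v0: "0 \<le> v s t" for s using potentialD(3)[OF Q t] .
  have M0: "0 \<le> M" using M[OF t, of 0] v0[of 0] by simp
  have half: "v b t powr m - v a t powr m \<le> \<mu> * (M powr m + M / (m - 1))" if ab: "\<bar>b - a\<bar> \<le> \<mu> * sqrt t" for a b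
  proof -
    define \<rho> where "\<rho> = \<bar>b - a\<bar> / sqrt t"
    \<comment> \<open>\<open>y\<close> lies at distance \<open>sqrt t\<close> from \<open>a\<close>
      on the side of \<open>b\<close>, so \<open>b\<close> divides the segment from \<open>a\<close>
      to \<open>y\<close> in the ratio given by \<open>\<rho>\<close>.\<close>
    define y where "y = a + (if b \<ge> a then sqrt t else - sqrt t)"
    have \<rho>: "0 \<le> \<rho>" "\<rho> \<le> \<mu>" using ab t by (auto simp: \<rho>_def field_simps)
    have b: "(1 - \<rho>) * a + (1 - (1 - \<rho>)) * y = b"
    proof -
      have "\<rho> * sqrt t = \<bar>b - a\<bar>" using t by (simp add: \<rho>_def)
      then show ?thesis by (simp add: y_def algebra_simps)
    qed
    have "(a - y)\<^sup>2 = t" using t by (simp add: y_def)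
    then have "v b t powr m \<le> (1 - \<rho>) * v a t powr m + \<rho> * v y t powr m + M / ((m - 1) * t) * ((1 - \<rho>) * \<rho> * t / 2)"
      using potential_semiconvex[OF m Q conv M t, where l = "1 - \<rho>" and x = a and y = y] \<rho> \<mu> unfolding b by simp
    also have "M / ((m - 1) * t) * ((1 - \<rho>) * \<rho> * t / 2) = \<rho> * (M / (m - 1)) * ((1 - \<rho>) / 2)"
      using t m by (simp add: divide_simps)
    also have "\<dots> \<le> \<rho> * (M / (m - 1)) * 1"
      using \<rho> m M0 by (intro mult_left_mono) auto
    also have "(1 - \<rho>) * v a t powr m \<le> 1 * v a t powr m"
      using \<rho> by (intro mult_right_mono) auto
    also have "\<rho> * v y t powr m \<le> \<rho> * M powr m"
      using \<rho> M[OF t] v0 m by (intro mult_left_mono powr_mono2) auto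
    finally have "v b t powr m - v a t powr m \<le> \<rho> * (M powr m + M / (m - 1))"
      by (simp add: algebra_simps)
    also have "\<dots> \<le> \<mu> * (M powr m + M / (m - 1))"
      using \<rho> M0 m by (intro mult_right_mono) auto
    finally show ?thesis .
  qed
  show ?thesis
  proof (cases "v s t \<le> v s' t")
    case True
    then show ?thesis
      using powr_superadditive[of m "v s t" "v s' t"] v0 m half[of s' s] near by simp
  next
    case False
    then show ?thesis
      using powr_superadditive[of m "v s' t" "v s t"] v0 m half[of s s'] near
      by (simp add: abs_minus_commute)
  qed
qed

section \<open>Asymptotic self-similarity and the value at the origin\<close>

lemma first_order_taylor_bound:
  fixes f :: "real \<Rightarrow> real"
  assumes f: "\<And>y. (f has_real_derivative f' y) (at y)"
    and b: "\<And>y. y \<in> closed_segment x0 x \<Longrightarrow> \<bar>f' y - f' x0\<bar> \<le> B"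
  shows "\<bar>f x - f x0 - f' x0 * (x - x0)\<bar> \<le> B * \<bar>x - x0\<bar>"
proof -
  have "norm ((f x - f' x0 * x) - (f x0 - f' x0 * x0)) \<le> B * norm (x - x0)"
    by (rule field_differentiable_bound[where S = "closed_segment x0 x" and f' = "\<lambda>y. f' y - f' x0"])
      (use b in \<open>auto intro!: derivative_eq_intros has_field_derivative_at_within[OF f]\<close>)
  then show ?thesis by (simp add: algebra_simps)
qed

lemma second_order_taylor_bound:
  fixes f :: "real \<Rightarrow> real"
  assumes f: "\<And>y. (f has_real_derivative f' y) (at y)"
    and f': "\<And>y. (f' has_real_derivative f'' y) (at y)"
    and N: "\<And>y. y \<in> closed_segment x0 x \<Longrightarrow> \<bar>f'' y\<bar> \<le> N"
  shows "\<bar>f x - f x0 - f' x0 * (x - x0)\<bar> \<le> N * (x - x0)\<^sup>2"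
proof -
  have N0: "0 \<le> N" using N[of x0] by force
  have "\<bar>f' y - f' x0\<bar> \<le> N * \<bar>x - x0\<bar>" if y: "y \<in> closed_segment x0 x" for y
  proof -
    have "norm (f' y - f' x0) \<le> N * norm (y - x0)"
      by (rule field_differentiable_bound[where S = "closed_segment x0 x" and f' = f''])
        (use N y in \<open>auto intro!: has_field_derivative_at_within[OF f']\<close>)
    moreover have "\<bar>y - x0\<bar> \<le> \<bar>x - x0\<bar>" using y by (auto simp: closed_segment_eq_real_ivl split: if_splits)
    ultimately show ?thesis using mult_left_mono[OF _ N0] by fastforce
  qed
  from first_order_taylor_bound[of f f' x0 x, OF f this] show ?thesis
    by (simp add: power2_eq_square mult.assoc)
qed

text \<open>The bump in the bound on \<open>f''\<close> has total integral
  \<open>2 * M * r * pi\<close>, so it contributes only a linear term to the deviation. Young's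
  inequality trades that term for a second small parabola and a constant, both independent of
  \<open>x0\<close>.\<close>

lemma affine_deviation:
  fixes f :: "real \<Rightarrow> real"
  assumes f: "\<And>y. (f has_real_derivative f' y) (at y)"
    and f': "\<And>y. (f' has_real_derivative f'' y) (at y)"
    and e: "0 < \<epsilon>" and M: "0 \<le> M" and r: "0 < r"
    and b: "\<And>y. \<bar>f'' y\<bar> \<le> \<epsilon> + 2 * M / (1 + (y / r)\<^sup>2)"
  shows "\<bar>f x - f x0 - f' x0 * (x - x0)\<bar> \<le> 2 * \<epsilon> * (x - x0)\<^sup>2 + (2 * M * r * pi)\<^sup>2 / (4 * \<epsilon>)"
proof -
  define P where "P = 2 * M * r * pi"
  \<comment> \<open>An explicit antiderivative of the bound on \<open>f''\<close>; both
    \<open>h - f'\<close> and \<open>h + f'\<close> are nondecreasing.\<close>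
  define h where "h = (\<lambda>y. \<epsilon> * y + 2 * M * r * arctan (y / r))"
  have dh: "(h has_real_derivative \<epsilon> + 2 * M / (1 + (y / r)\<^sup>2)) (at y)" for y
  proof -
    have "((\<lambda>y. arctan (y / r)) has_real_derivative inverse (1 + (y / r)\<^sup>2) * (1 / r)) (at y)"
      by (rule DERIV_chain2[OF DERIV_arctan]) (use r in \<open>auto intro!: derivative_eq_intros\<close>)
    from DERIV_add[OF DERIV_cmult[OF DERIV_ident, of \<epsilon>] DERIV_cmult[OF this, of "2 * M * r"]]
    have "(h has_real_derivative \<epsilon> * 1 + 2 * M * r * (inverse (1 + (y / r)\<^sup>2) * (1 / r))) (at y)"
      by (simp add: h_def)
    moreover have "2 * M * r * (inverse X * (1 / r)) = 2 * M / X" for X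
      using r by (simp add: divide_inverse)
    ultimately show ?thesis by simp
  qed
  have var: "\<bar>f' y - f' x\<bar> \<le> \<epsilon> * (y - x) + P" if "x \<le> y" for x y
  proof -
    have "h x - f' x \<le> h y - f' y"
    proof (rule DERIV_nonneg_imp_nondecreasing[OF that], intro exI conjI)
      show "((\<lambda>x. h x - f' x) has_real_derivative \<epsilon> + 2 * M / (1 + (z / r)\<^sup>2) - f'' z) (at z)" for z
        by (rule DERIV_diff[OF dh f'])
      show "0 \<le> \<epsilon> + 2 * M / (1 + (z / r)\<^sup>2) - f'' z" for z
        using b[of z] by linarith
    qed
    moreover have "h x + f' x \<le> h y + f' y"
    proof (rule DERIV_nonneg_imp_nondecreasing[OF that], intro exI conjI)
      show "((\<lambda>x. h x + f' x) has_real_derivative \<epsilon> + 2 * M / (1 + (z / r)\<^sup>2) + f'' z) (at z)" for z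
        by (rule DERIV_add[OF dh f'])
      show "0 \<le> \<epsilon> + 2 * M / (1 + (z / r)\<^sup>2) + f'' z" for z
        using b[of z] by linarith
    qed
    moreover have "2 * M * r * (arctan (y / r) - arctan (x / r)) \<le> 2 * M * r * pi"
      using arctan_ubound[of "y / r"] arctan_lbound[of "x / r"] M r by (intro mult_left_mono) auto
    then have "h y - h x \<le> \<epsilon> * (y - x) + P" by (simp add: h_def P_def algebra_simps)
    ultimately show ?thesis by linarith
  qed
  have "\<bar>f' y - f' x0\<bar> \<le> \<epsilon> * \<bar>x - x0\<bar> + P" if y: "y \<in> closed_segment x0 x" for y
  proof -
    have "\<bar>f' y - f' x0\<bar> \<le> \<epsilon> * \<bar>y - x0\<bar> + P"
      using var[of x0 y] var[of y x0] by (cases "x0 \<le> y") auto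
    moreover have "\<bar>y - x0\<bar> \<le> \<bar>x - x0\<bar>" using y by (auto simp: closed_segment_eq_real_ivl split: if_splits)
    then have "\<epsilon> * \<bar>y - x0\<bar> \<le> \<epsilon> * \<bar>x - x0\<bar>" using e by (intro mult_left_mono) auto
    ultimately show ?thesis by simp
  qed
  from first_order_taylor_bound[of f f' x0 x, OF f this]
  have "\<bar>f x - f x0 - f' x0 * (x - x0)\<bar> \<le> \<epsilon> * (x - x0)\<^sup>2 + P * \<bar>x - x0\<bar>"
    by (simp add: power2_eq_square distrib_right mult.assoc)
  moreover have "P * \<bar>x - x0\<bar> \<le> \<epsilon> * (x - x0)\<^sup>2 + P\<^sup>2 / (4 * \<epsilon>)"
  proof -
    have "0 \<le> (2 * \<epsilon> * \<bar>x - x0\<bar> - P)\<^sup>2" by simp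
    also have "\<dots> = 4 * \<epsilon> * (\<epsilon> * (x - x0)\<^sup>2 - P * \<bar>x - x0\<bar>) + P\<^sup>2"
      by (simp add: power2_diff power_mult_distrib algebra_simps) (simp add: power2_eq_square)
    finally show ?thesis using e by (simp add: field_simps)
  qed
  ultimately show ?thesis by (simp add: P_def)
qed

text \<open>A dilation with \<open>a \<ge> 1\<close> moves points outward, so beyond
  \<open>r\<close> both values are close to the same limit, whatever \<open>a\<close> is. For
  \<open>\<bar>s\<bar> \<le> r\<close> the bump alone is at least \<open>M\<close>; its shape is
  chosen for its arctan antiderivative.\<close>

lemma dilation_difference_bound:
  fixes v0 :: "real \<Rightarrow> real"
  assumes v0: "\<And>s. 0 \<le> v0 s" "\<And>s. v0 s \<le> M" and e: "\<epsilon> > 0"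
    and lim: "(v0 \<longlongrightarrow> K) at_bot" "(v0 \<longlongrightarrow> K') at_top"
  obtains r where "r > 0" "\<And>a s. 1 \<le> a \<Longrightarrow> \<bar>v0 (a * s) - v0 s\<bar> \<le> \<epsilon> + 2 * M / (1 + (s / r)\<^sup>2)"
proof -
  have e2: "\<epsilon> / 2 > 0" using e by simp
  obtain N1 where N1: "\<And>s. s \<le> N1 \<Longrightarrow> \<bar>v0 s - K\<bar> < \<epsilon> / 2"
    using tendstoD[OF lim(1) e2] by (auto simp: eventually_at_bot_linorder dist_real_def)
  obtain N2 where N2: "\<And>s. s \<ge> N2 \<Longrightarrow> \<bar>v0 s - K'\<bar> < \<epsilon> / 2"
    using tendstoD[OF lim(2) e2] by (auto simp: eventually_at_top_linorder dist_real_def)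
  define r where "r = max 1 (max (- N1) N2)"
  have r: "r > 0" by (simp add: r_def)
  have M: "0 \<le> M" using v0[of 0] by simp
  show thesis
  proof (rule that[OF r])
    fix a s :: real assume a: "1 \<le> a"
    have nn: "0 \<le> 2 * M / (1 + (s / r)\<^sup>2)" using M by simp
    consider "s \<le> - r" | "s \<ge> r" | "\<bar>s\<bar> \<le> r" by linarith
    then show "\<bar>v0 (a * s) - v0 s\<bar> \<le> \<epsilon> + 2 * M / (1 + (s / r)\<^sup>2)"
    proof cases
      case 1
      then have "a * s \<le> 1 * s" using a r by (intro mult_right_mono_neg) auto
      then have "\<bar>v0 (a * s) - K\<bar> < \<epsilon> / 2" "\<bar>v0 s - K\<bar> < \<epsilon> / 2"
        using 1 N1[of s] N1[of "a * s"] by (auto simp: r_def)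
      then show ?thesis using nn by linarith
    next
      case 2
      then have "1 * s \<le> a * s" using a r by (intro mult_right_mono) auto
      then have "\<bar>v0 (a * s) - K'\<bar> < \<epsilon> / 2" "\<bar>v0 s - K'\<bar> < \<epsilon> / 2"
        using 2 N2[of s] N2[of "a * s"] by (auto simp: r_def)
      then show ?thesis using nn by linarith
    next
      case 3
      then have "(s / r)\<^sup>2 \<le> 1" using r by (simp add: abs_square_le_1)
      then have "M \<le> 2 * M / (1 + (s / r)\<^sup>2)"
        using M mult_left_mono[of "(s / r)\<^sup>2" 1 M] by (simp add: field_simps add_pos_nonneg)
      moreover have "\<bar>v0 (a * s) - v0 s\<bar> \<le> M" using v0[of s] v0[of "a * s"] by linarith
      ultimately show ?thesis using e by linarith
    qed
  qed
qed

text \<open>Both \<open>v\<close> and its dilation have the same limits at \<open>\<plusminus>\<infinity>\<close>, so up to affine functions their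
  potentials differ initially by at most a small parabola plus a constant, uniformly in the vertex of
  the parabola; the barrier propagates this, and second differences recover \<open>v\<close>.\<close>

lemma dilations_asymptotically_equal:
  assumes m: "m > 1" and Q: "potential m v Q Q'"
    and Q1: "\<And>s. ((\<lambda>s. Q s 0) has_real_derivative Q0' s) (at s)"
    and Q2: "\<And>s. (Q0' has_real_derivative v0 s) (at s)"
    and v0: "\<And>s. 0 \<le> v0 s" "\<And>s. v0 s \<le> M" and M: "0 < M"
    and lim: "(v0 \<longlongrightarrow> K) at_bot" "(v0 \<longlongrightarrow> K') at_top" and \<delta>: "\<delta> > 0"
  obtains T where "T > 0" "\<And>t a s. T \<le> t \<Longrightarrow> 1 \<le> a \<Longrightarrow> \<bar>v (a * s) (a\<^sup>2 * t) - v s t\<bar> \<le> \<delta>"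
proof -
  define \<Lambda> where "\<Lambda> = M powr m + M / (m - 1)"
  have \<Lambda>: "\<Lambda> > 0" using M m by (simp add: \<Lambda>_def add_pos_pos)
  \<comment> \<open>Within distance \<open>\<mu> * sqrt t\<close> equicontinuity changes a solution
    by at most \<open>\<delta> / 3\<close>.\<close>
  define \<mu> where "\<mu> = min 1 ((\<delta> / 3) powr m / \<Lambda>)"
  have \<mu>: "0 < \<mu>" "\<mu> \<le> 1" using \<Lambda> \<delta> by (auto simp: \<mu>_def)
  have \<mu>\<Lambda>: "\<mu> * \<Lambda> \<le> (\<delta> / 3) powr m" using \<Lambda> by (simp add: \<mu>_def min_def field_simps)
  define E where "E = cosh 1 * exp (m * M powr (m - 1) + 1)"
  have E: "E > 0" by (simp add: E_def)
  \<comment> \<open>The second difference is to stay below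
    \<open>\<mu>\<^sup>2 * t * (\<delta> / 3)\<close>. This \<open>\<epsilon>\<close> makes the
    parabola use half of that, and \<open>T\<close> makes the constant \<open>C\<close> use at most
    the other half.\<close>
  define \<epsilon> where "\<epsilon> = \<delta> * \<mu>\<^sup>2 / (192 * E)"
  have e: "\<epsilon> > 0" using \<delta> \<mu> E by (simp add: \<epsilon>_def)
  obtain r where r: "r > 0" and w0: "\<And>a s. 1 \<le> a \<Longrightarrow> \<bar>v0 (a * s) - v0 s\<bar> \<le> \<epsilon> + 2 * M / (1 + (s / r)\<^sup>2)"
    using dilation_difference_bound[OF v0 e lim] by blast
  define C where "C = (2 * M * r * pi)\<^sup>2 / (4 * \<epsilon>)"
  have C: "C > 0" using M r e pi_gt_zero by (simp add: C_def)
  define T where "T = 24 * C / (\<mu>\<^sup>2 * \<delta>)"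
  have T: "T > 0" using C \<mu> \<delta> by (simp add: T_def)
  have conv: "convex_on UNIV (\<lambda>s. Q s 0)"
    by (rule f''_ge0_imp_convex[OF convex_UNIV Q1 Q2 v0(1)])
  have vM: "v s t \<le> M" if "0 < t" for s t
    by (rule potential_le_bound[OF m Q Q1 Q2 v0(2) _ that]) (use M in auto)
  show thesis
  proof (rule that[OF T])
    fix t a s0 :: real assume t: "T \<le> t" and a: "1 \<le> a"
    have t0: "0 < t" and a0: "0 < a" "0 < a\<^sup>2" using T t a by auto
    define V where "V = (\<lambda>s t. 1 * v (a * s) (a\<^sup>2 * t))"
    define R where "R = (\<lambda>s t. 1 / a\<^sup>2 * Q (a * s) (a\<^sup>2 * t))"
    define R' where "R' = (\<lambda>s t. 1 / a * Q' (a * s) (a\<^sup>2 * t))"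
    have R: "potential m V R R'"
      unfolding V_def R_def R'_def by (rule potential_rescale[OF Q zero_less_one a0]) simp
    have VM: "V s t \<le> M" if "0 < t" for s t using vM that a0 by (simp add: V_def)
    have R1: "((\<lambda>s. R s 0) has_real_derivative 1 / a * Q0' (a * s)) (at s)" for s
    proof -
      have "((\<lambda>s. Q (a * s) 0) has_real_derivative Q0' (a * s) * a) (at s)"
        by (rule DERIV_chain2[OF Q1]) (auto intro!: derivative_eq_intros)
      from DERIV_cmult[OF this, of "1 / a\<^sup>2"] show ?thesis
        using a0 by (simp add: R_def power2_eq_square field_simps)
    qed
    have R2: "((\<lambda>s. 1 / a * Q0' (a * s)) has_real_derivative v0 (a * s)) (at s)" for s
    proof -
      have "((\<lambda>s. Q0' (a * s)) has_real_derivative v0 (a * s) * a) (at s)"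
        by (rule DERIV_chain2[OF Q2]) (auto intro!: derivative_eq_intros)
      from DERIV_cmult[OF this, of "1 / a"] show ?thesis using a0 by simp
    qed
    have convR: "convex_on UNIV (\<lambda>s. R s 0)"
      by (rule f''_ge0_imp_convex[OF convex_UNIV R1 R2 v0(1)])
    \<comment> \<open>\<open>\<alpha>\<close> and \<open>\<beta>\<close> are the first-order Taylor
      data at \<open>s0\<close> of the initial difference of potentials. They depend on
      \<open>a\<close> and \<open>s0\<close>, but the remaining error does not.\<close>
    define \<alpha> where "\<alpha> = R s0 0 - Q s0 0"
    define \<beta> where "\<beta> = 1 / a * Q0' (a * s0) - Q0' s0"
    \<comment> \<open>With this scale \<open>\<theta>\<^sup>2 * t = 1\<close>, so for
      \<open>\<bar>s - s0\<bar> \<le> sqrt t\<close> the barrier grows only by the fixed factor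
      \<open>E\<close>.\<close>
    define \<theta> where "\<theta> = 1 / sqrt t"
    have \<theta>: "\<theta> > 0" "\<theta>\<^sup>2 = 1 / t" using t0 by (auto simp: \<theta>_def power_divide)
    have "\<bar>R s 0 - Q s 0 - (\<alpha> + \<beta> * (s - s0))\<bar> \<le> 8 * \<epsilon> * t * cosh (\<theta> * (s - s0)) + C" for s
    proof -
      have "\<bar>(R s 0 - Q s 0) - (R s0 0 - Q s0 0) - (1 / a * Q0' (a * s0) - Q0' s0) * (s - s0)\<bar>
          \<le> 2 * \<epsilon> * (s - s0)\<^sup>2 + (2 * M * r * pi)\<^sup>2 / (4 * \<epsilon>)"
        by (rule affine_deviation[OF DERIV_diff[OF R1 Q1] DERIV_diff[OF R2 Q2] e less_imp_le[OF M] r w0[OF a]])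
      moreover have "(s - s0)\<^sup>2 \<le> t * (4 * cosh (\<theta> * (s - s0)))"
      proof -
        have "(\<theta> * (s - s0))\<^sup>2 \<le> 4 * cosh (\<theta> * (s - s0))" using cosh_ge_quadratic[of "\<theta> * (s - s0)"] by simp
        then have "t * (\<theta> * (s - s0))\<^sup>2 \<le> t * (4 * cosh (\<theta> * (s - s0)))"
          using t0 by (intro mult_left_mono) auto
        then show ?thesis using t0 \<theta> by (simp add: power_mult_distrib)
      qed
      then have "2 * \<epsilon> * (s - s0)\<^sup>2 \<le> 2 * \<epsilon> * (t * (4 * cosh (\<theta> * (s - s0))))"
        using e by (intro mult_left_mono) auto
      ultimately show ?thesis by (simp add: \<alpha>_def \<beta>_def C_def diff_diff_eq)
    qed
    note barrier = potential_barrier[OF m Q R vM VM this]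
    have dev: "\<bar>R s t - Q s t - (\<alpha> + \<beta> * (s - s0))\<bar> \<le> 8 * \<epsilon> * t * E + C" if "\<bar>s - s0\<bar> \<le> sqrt t" for s
    proof -
      have "\<bar>\<theta> * (s - s0)\<bar> \<le> 1" using that t0 by (simp add: \<theta>_def abs_mult)
      then have "cosh (\<theta> * (s - s0)) \<le> cosh 1"
        using cosh_real_nonneg_le_iff[of "\<bar>\<theta> * (s - s0)\<bar>" 1] by (simp add: cosh_real_abs)
      then have "8 * \<epsilon> * t * cosh (\<theta> * (s - s0)) * exp ((m * M powr (m - 1) + 1) * \<theta>\<^sup>2 * t)
          \<le> 8 * \<epsilon> * t * cosh 1 * exp ((m * M powr (m - 1) + 1) * \<theta>\<^sup>2 * t)"
        using e t0 by (intro mult_right_mono mult_left_mono) auto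
      also have "\<dots> = 8 * \<epsilon> * t * E" using t0 \<theta> by (simp add: E_def)
      finally have "8 * \<epsilon> * t * cosh (\<theta> * (s - s0)) * exp ((m * M powr (m - 1) + 1) * \<theta>\<^sup>2 * t)
          \<le> 8 * \<epsilon> * t * E" .
      moreover have "\<bar>R s t - Q s t - (\<alpha> + \<beta> * (s - s0))\<bar>
          \<le> 8 * \<epsilon> * t * cosh (\<theta> * (s - s0)) * exp ((m * M powr (m - 1) + 1) * \<theta>\<^sup>2 * t) + C"
        by (rule barrier) (use e t0 \<theta> in auto)
      ultimately show ?thesis by linarith
    qed
    define k where "k = \<mu> * sqrt t"
    have k: "0 < k" "k \<le> sqrt t" using \<mu> t0 by (auto simp: k_def)
    obtain \<xi> where \<xi>: "\<bar>\<xi> - s0\<bar> \<le> k"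
      "(R (s0 + k) t - Q (s0 + k) t) + (R (s0 - k) t - Q (s0 - k) t) - 2 * (R s0 t - Q s0 t)
        = k\<^sup>2 * (V \<xi> t - v \<xi> t)"
    proof (rule second_difference_mvt[where f = "\<lambda>s. R s t - Q s t" and f' = "\<lambda>s. R' s t - Q' s t"
          and f'' = "\<lambda>s. V s t - v s t" and k = k and s = s0])
      show "((\<lambda>s. R s t - Q s t) has_real_derivative R' y t - Q' y t) (at y)" for y
        using potentialD(4)[OF Q t0] potentialD(4)[OF R t0] by (auto intro!: derivative_eq_intros)
      show "((\<lambda>s. R' s t - Q' s t) has_real_derivative V y t - v y t) (at y)" for y
        using potentialD(5)[OF Q t0] potentialD(5)[OF R t0] by (auto intro!: derivative_eq_intros)
    qed (use k in auto)
    \<comment> \<open>The affine function drops out of the second difference; the weights 1, 1 and 2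
      add up to the factor 4.\<close>
    have "\<bar>k\<^sup>2 * (V \<xi> t - v \<xi> t)\<bar> \<le> 4 * (8 * \<epsilon> * t * E + C)"
      using dev[of "s0 + k"] dev[of "s0 - k"] dev[of s0] k t0 unfolding \<xi>(2)[symmetric]
      by (simp add: abs_le_iff)
    then have "\<mu>\<^sup>2 * t * \<bar>V \<xi> t - v \<xi> t\<bar> \<le> 4 * (8 * \<epsilon> * t * E + C)"
      using t0 by (simp add: k_def power_mult_distrib abs_mult)
    also have "\<dots> \<le> \<mu>\<^sup>2 * t * (\<delta> / 3)"
    proof -
      have C24: "24 * C \<le> \<mu>\<^sup>2 * \<delta> * t" using t \<mu> \<delta> by (simp add: T_def field_simps)
      have eE: "\<epsilon> * E = \<delta> * \<mu>\<^sup>2 / 192" using E by (simp add: \<epsilon>_def)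
      have "4 * (8 * \<epsilon> * t * E + C) = 32 * t * (\<epsilon> * E) + 4 * C" by (simp add: algebra_simps)
      also have "\<dots> = 32 * t * (\<delta> * \<mu>\<^sup>2 / 192) + 4 * C" by (simp only: eE)
      also have "\<dots> \<le> \<mu>\<^sup>2 * t * (\<delta> / 3)" using C24 by (simp add: algebra_simps)
      finally show ?thesis .
    qed
    finally have mid: "\<bar>V \<xi> t - v \<xi> t\<bar> \<le> \<delta> / 3" using \<mu> t0 by simp
    have root: "x \<le> \<delta> / 3" if "x powr m \<le> \<mu> * \<Lambda>" "0 \<le> x" for x
      using that \<mu>\<Lambda> \<delta> m powr_less_mono2[of m "\<delta> / 3" x] by (cases "\<delta> / 3 < x") auto
    have near: "\<bar>s0 - \<xi>\<bar> \<le> \<mu> * sqrt t" using \<xi>(1) by (simp add: k_def abs_minus_commute)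
    have "\<bar>v s0 t - v \<xi> t\<bar> \<le> \<delta> / 3"
      using potential_equicontinuous[OF m Q conv vM t0 less_imp_le[OF \<mu>(1)] \<mu>(2) near] by (intro root) (auto simp: \<Lambda>_def)
    moreover have "\<bar>V s0 t - V \<xi> t\<bar> \<le> \<delta> / 3"
      using potential_equicontinuous[OF m R convR VM t0 less_imp_le[OF \<mu>(1)] \<mu>(2) near] by (intro root) (auto simp: \<Lambda>_def)
    ultimately have "\<bar>V s0 t - v s0 t\<bar> \<le> \<delta>" using mid by linarith
    then show "\<bar>v (a * s0) (a\<^sup>2 * t) - v s0 t\<bar> \<le> \<delta>" by (simp add: V_def)
  qed
qed

section \<open>Behaviour near minus infinity\<close>

text \<open>Far to the left the data are almost the constant \<open>K\<close>, and the barrier with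
  \<open>\<theta> = 1\<close> damps the influence of distant data. The time integral of
  \<open>v powr m\<close> is therefore asymptotically that of the constant solution.\<close>

lemma potential_left_limit:
  assumes m: "m > 1" and Q: "potential m v Q Q'"
    and Q1: "\<And>s. ((\<lambda>s. Q s 0) has_real_derivative Q0' s) (at s)"
    and Q2: "\<And>s. (Q0' has_real_derivative v0 s) (at s)"
    and v0: "\<And>s. 0 \<le> v0 s" "\<And>s. v0 s \<le> M" and K: "0 \<le> K" "K \<le> M"
    and lim: "(v0 \<longlongrightarrow> K) at_bot" and t: "0 \<le> t"
  shows "((\<lambda>s. Q s t - Q s 0) \<longlongrightarrow> K powr m * t) at_bot"
proof (rule tendstoI)
  fix \<eta> :: real assume \<eta>: "\<eta> > 0"
  define E where "E = exp ((m * M powr (m - 1) + 1) * t)"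
  have E: "E > 0" by (simp add: E_def)
  define \<epsilon> where "\<epsilon> = \<eta> / (16 * E)"
  have e: "\<epsilon> > 0" using \<eta> E by (simp add: \<epsilon>_def)
  \<comment> \<open>Data at distance at least \<open>d\<close> then contribute at most
    \<open>\<eta> / 4\<close>, and the nearby data, with error \<open>\<epsilon>\<close>, another
    \<open>\<eta> / 4\<close>.\<close>
  define d where "d = sqrt (512 * M * E / \<eta> + 1)"
  have d: "d > 0" "d\<^sup>2 = 512 * M * E / \<eta> + 1" using K E \<eta> by (auto simp: d_def add_nonneg_pos)
  obtain S where S: "\<And>s. s \<le> S \<Longrightarrow> \<bar>v0 s - K\<bar> < \<epsilon>"
    using tendstoD[OF lim e] by (auto simp: eventually_at_bot_linorder dist_real_def)
  define b where "b = 4 * \<epsilon> + 128 * M / d\<^sup>2"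
  have "128 * M / d\<^sup>2 * E \<le> \<eta> / 4"
    using K E \<eta> d by (simp add: field_simps add_nonneg_pos)
  then have bE: "b * E < \<eta>" using E \<eta> by (simp add: b_def \<epsilon>_def distrib_right)
  have b0: "0 \<le> b" using e K by (simp add: b_def)
  have vM: "v s t \<le> M" if "0 < t" for s t
    by (rule potential_le_bound[OF m Q Q1 Q2 v0(2) _ that]) (use K in auto)
  define R where "R = (\<lambda>s t. K * s\<^sup>2 / 2 + K powr m * t)"
  have R: "potential m (\<lambda>s t. K) R (\<lambda>s t. K * s)"
    unfolding R_def by (rule potential_constant[OF K(1)])
  have "dist (Q s0 t - Q s0 0) (K powr m * t) < \<eta>" if s0: "s0 \<le> S - d" for s0
  proof -
    define \<alpha> where "\<alpha> = R s0 0 - Q s0 0"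
    define \<beta> where "\<beta> = K * s0 - Q0' s0"
    have D1: "((\<lambda>s. R s 0 - Q s 0) has_real_derivative K * s - Q0' s) (at s)" for s
      unfolding R_def by (auto intro!: derivative_eq_intros Q1)
    have D2: "((\<lambda>s. K * s - Q0' s) has_real_derivative K - v0 s) (at s)" for s
      by (auto intro!: derivative_eq_intros Q2)
    have "\<bar>R s 0 - Q s 0 - (\<alpha> + \<beta> * (s - s0))\<bar> \<le> b * cosh (1 * (s - s0)) + 0" for s
    proof (cases "s \<le> S")
      case True
      have "\<bar>(R s 0 - Q s 0) - (R s0 0 - Q s0 0) - (K * s0 - Q0' s0) * (s - s0)\<bar> \<le> \<epsilon> * (s - s0)\<^sup>2"
      proof (rule second_order_taylor_bound[OF D1 D2])
        fix y assume "y \<in> closed_segment s0 s"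
        then have "y \<le> S" using True s0 d by (auto simp: closed_segment_eq_real_ivl split: if_splits)
        then show "\<bar>K - v0 y\<bar> \<le> \<epsilon>" using S[of y] by linarith
      qed
      also have "\<dots> \<le> \<epsilon> * (4 * cosh (s - s0))"
        using cosh_ge_quadratic[of "s - s0"] e by (intro mult_left_mono) auto
      also have "\<dots> \<le> b * cosh (s - s0)"
        unfolding b_def distrib_right using K by (simp add: mult.assoc)
      finally show ?thesis by (simp add: \<alpha>_def \<beta>_def diff_diff_eq)
    next
      case False
      define x where "x = s - s0"
      have x: "d \<le> x" using False s0 by (simp add: x_def)
      have "\<bar>(R s 0 - Q s 0) - (R s0 0 - Q s0 0) - (K * s0 - Q0' s0) * (s - s0)\<bar> \<le> M * (s - s0)\<^sup>2"
      proof (rule second_order_taylor_bound[OF D1 D2])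
        show "\<bar>K - v0 y\<bar> \<le> M" for y using v0[of y] K by linarith
      qed
      \<comment> \<open>Since \<open>x \<ge> d\<close>, one factor \<open>d\<^sup>2\<close> is
        gained from the quartic bound, so the coefficient of cosh is small although the error in the
        data is not.\<close>
      also have "(s - s0)\<^sup>2 \<le> 128 / d\<^sup>2 * cosh x"
      proof -
        have "d\<^sup>2 * x\<^sup>2 \<le> x\<^sup>2 * x\<^sup>2" using x d by (intro mult_right_mono power_mono) auto
        also have "\<dots> \<le> 128 * cosh x" using cosh_ge_quartic[of x] by (simp add: power4_eq_xxxx power2_eq_square mult.assoc)
        finally show ?thesis using d(1) by (simp add: x_def field_simps)
      qed
      then have "M * (s - s0)\<^sup>2 \<le> M * (128 / d\<^sup>2 * cosh x)" using K by (intro mult_left_mono) auto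
      also have "\<dots> \<le> b * cosh x"
        unfolding b_def distrib_right using e by (simp add: mult_ac)
      finally show ?thesis by (simp add: \<alpha>_def \<beta>_def x_def diff_diff_eq)
    qed
    from potential_barrier[OF m Q R vM K(2) this b0 zero_less_one t, of s0]
    have "\<bar>R s0 t - Q s0 t - \<alpha>\<bar> \<le> b * E" by (simp add: E_def)
    then show ?thesis using bE by (simp add: R_def \<alpha>_def dist_real_def abs_if split: if_splits)
  qed
  then show "\<forall>\<^sub>F s in at_bot. dist (Q s t - Q s 0) (K powr m * t) < \<eta>"
    unfolding eventually_at_bot_linorder by blast
qed

section \<open>Regularity of the time integral\<close>

lemma continuous_has_antiderivative:
  fixes f :: "real \<Rightarrow> real"
  assumes "continuous_on UNIV f"
  obtains F where "\<And>x. (F has_real_derivative f x) (at x)"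
proof -
  have "isCont f x" for x using assms by (simp add: continuous_on_eq_continuous_at)
  then have "\<exists>F. \<forall>x. (-\<infinity>) < ereal x \<longrightarrow> ereal x < \<infinity> \<longrightarrow> (F has_vector_derivative f x) (at x)"
    by (intro einterval_antiderivative) auto
  then show thesis using that by (auto simp: has_real_derivative_iff_has_vector_derivative)
qed

text \<open>The two free constants of a second antiderivative are spent on the boundary values, by
  adding an affine function.\<close>

lemma continuous_has_second_antiderivative:
  fixes f :: "real \<Rightarrow> real"
  assumes f: "continuous_on UNIV f" and ab: "a < b"
  obtains F F' where "\<And>x. (F has_real_derivative F' x) (at x)" "\<And>x. (F' has_real_derivative f x) (at x)"
    "F a = \<alpha>" "F b = \<beta>"
proof -
  obtain G' where G': "\<And>x. (G' has_real_derivative f x) (at x)"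
    using continuous_has_antiderivative[OF f] by blast
  then have "continuous_on UNIV G'" by (meson DERIV_isCont continuous_at_imp_continuous_on)
  then obtain G where G: "\<And>x. (G has_real_derivative G' x) (at x)"
    using continuous_has_antiderivative by blast
  define c where "c = ((\<beta> - G b) - (\<alpha> - G a)) / (b - a)"
  show thesis
  proof (rule that)
    show "((\<lambda>x. G x + (\<alpha> - G a) + c * (x - a)) has_real_derivative G' x + c) (at x)" for x
      by (auto intro!: derivative_eq_intros G)
    show "((\<lambda>x. G' x + c) has_real_derivative f x) (at x)" for x
      by (auto intro!: derivative_eq_intros G')
    show "G b + (\<alpha> - G a) + c * (b - a) = \<beta>" using ab by (simp add: c_def)
  qed simp
qed

lemma jointly_continuous_if_locally_lipschitz_in_time:
  fixes f :: "real \<Rightarrow> real \<Rightarrow> real"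
  assumes cont: "\<And>t. 0 \<le> t \<Longrightarrow> continuous_on UNIV (\<lambda>s. f s t)"
    and lip: "\<And>T. \<exists>B. \<forall>s. \<forall>t\<in>{0..T}. \<forall>t'\<in>{0..T}. \<bar>f s t - f s t'\<bar> \<le> B * \<bar>t - t'\<bar>"
  shows "continuous_on (UNIV \<times> {0..}) (\<lambda>(s,t). f s t)"
  unfolding continuous_on_iff
proof (intro ballI allI impI)
  fix x :: "real \<times> real" and e :: real assume "x \<in> UNIV \<times> {0..}" and e: "e > 0"
  then obtain s t where x: "x = (s, t)" and t: "t \<ge> 0" by auto
  obtain B where B: "\<And>s t1 t2. t1 \<in> {0..t + 1} \<Longrightarrow> t2 \<in> {0..t + 1} \<Longrightarrow> \<bar>f s t1 - f s t2\<bar> \<le> B * \<bar>t1 - t2\<bar>"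
    using lip by blast
  define C where "C = \<bar>B\<bar> + 1"
  have C: "C > 0" by (simp add: C_def)
  obtain d where d: "d > 0" "\<And>s'. dist s' s < d \<Longrightarrow> dist (f s' t) (f s t) < e / 2"
    using cont[OF t] e unfolding continuous_on_iff by (metis UNIV_I half_gt_zero)
  define d' where "d' = min (min d 1) (e / (2 * C))"
  have "dist (f s' t') (f s t) < e" if t': "t' \<ge> 0" and near: "dist (s', t') (s, t) < d'" for s' t'
  proof -
    have "dist s' s < d'" "dist t' t < d'"
      using near dist_fst_le[of "(s', t')" "(s, t)"] dist_snd_le[of "(s', t')" "(s, t)"] by auto
    then have "dist s' s < d" and tt: "\<bar>t' - t\<bar> < 1" "\<bar>t' - t\<bar> < e / (2 * C)"
      by (auto simp: d'_def dist_real_def)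
    have "\<bar>f s' t' - f s' t\<bar> \<le> B * \<bar>t' - t\<bar>" using tt t t' by (intro B) auto
    also have "\<dots> \<le> C * \<bar>t' - t\<bar>" by (intro mult_right_mono) (auto simp: C_def)
    also have "\<dots> < e / 2" using tt(2) C by (simp add: field_simps)
    finally show ?thesis using d(2)[OF \<open>dist s' s < d\<close>] unfolding dist_real_def prod.case by linarith
  qed
  moreover have "d' > 0" using d e C by (simp add: d'_def)
  ultimately show "\<exists>d>0. \<forall>x'\<in>UNIV \<times> {0..}. dist x' x < d \<longrightarrow>
      dist (case x' of (s, t) \<Rightarrow> f s t) (case x of (s, t) \<Rightarrow> f s t) < e"
    unfolding x by (intro exI[of _ d']) auto
qed

section \<open>Time integrals of a function that is continuous at positive times and locally
  bounded\<close>

context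
  fixes p :: "real \<Rightarrow> real \<Rightarrow> real"
  assumes cont: "continuous_on (UNIV \<times> {0<..}) (\<lambda>(s,t). p s t)"
    and bdd: "\<And>T. \<exists>B. \<forall>s. \<forall>t\<in>{0<..T}. \<bar>p s t\<bar> \<le> B"
begin

lemma time_slice_continuous: "continuous_on {0<..} (p s)"
  using continuous_on_compose2[OF cont, of "{0<..}" "\<lambda>t. (s, t)"]
  by (fastforce intro!: continuous_intros)

lemma space_slice_continuous: "0 < t \<Longrightarrow> continuous_on UNIV (\<lambda>s. p s t)"
  using continuous_on_compose2[OF cont, of UNIV "\<lambda>s. (s, t)"]
  by (fastforce intro!: continuous_intros)

text \<open>Continuity may fail at time 0, so integrability comes from measurability and boundedness
  on the half-open interval.\<close>

lemma time_integrable_Ioc: "p s integrable_on {0<..t}"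
proof -
  obtain B where B: "\<And>s t'. t' \<in> {0<..t} \<Longrightarrow> \<bar>p s t'\<bar> \<le> B" using bdd by blast
  show ?thesis
  proof (rule measurable_bounded_by_integrable_imp_integrable_real)
    show "p s \<in> borel_measurable (lebesgue_on {0<..t})"
      by (intro continuous_imp_measurable_on_sets_lebesgue continuous_on_subset[OF time_slice_continuous]) auto
    show "(\<lambda>_. B) integrable_on {0<..t}"
      using integrable_const_ivl[of B 0 t]
      by (rule integrable_spike_set) (rule negligible_subset[of "{0}"]; force)+
  qed (use B in auto)
qed

lemma time_integrable: "p s integrable_on {0..t}"
  using time_integrable_Ioc[of s t]
  by (rule integrable_spike_set) (rule negligible_subset[of "{0}"]; force)+

lemma time_integral_derivative:
  assumes t: "0 < t"
  shows "((\<lambda>t. integral {0..t} (p s)) has_real_derivative p s t) (at t)"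
proof -
  \<comment> \<open>Splitting the integral at \<open>t/2\<close> keeps the fundamental theorem away
    from time 0.\<close>
  have "((\<lambda>x. integral {t/2..x} (p s)) has_real_derivative p s t) (at t within {t/2..t+1})"
    using t by (intro integral_has_real_derivative continuous_on_subset[OF time_slice_continuous]) auto
  then have "((\<lambda>x. integral {t/2..x} (p s)) has_real_derivative p s t) (at t)"
    using t by (subst (asm) at_within_interior) auto
  then have "((\<lambda>x. integral {0..t/2} (p s) + integral {t/2..x} (p s)) has_real_derivative p s t) (at t)"
    by (auto intro!: derivative_eq_intros)
  then show ?thesis
  proof (rule has_field_derivative_transform_within_open[where S = "{t/2<..}"])
    show "integral {0..t / 2} (p s) + integral {t / 2..x} (p s) = integral {0..x} (p s)"
      if "x \<in> {t/2<..}" for x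
      using that t by (intro Henstock_Kurzweil_Integration.integral_combine time_integrable) auto
  qed (use t in auto)
qed

lemma time_integral_lipschitz:
  "\<exists>B. \<forall>s. \<forall>t\<in>{0..T}. \<forall>t'\<in>{0..T}. \<bar>integral {0..t} (p s) - integral {0..t'} (p s)\<bar> \<le> B * \<bar>t - t'\<bar>"
proof -
  obtain B where B: "\<And>s t'. t' \<in> {0<..T} \<Longrightarrow> \<bar>p s t'\<bar> \<le> B" using bdd by blast
  have half: "\<bar>integral {0..t'} (p s) - integral {0..t} (p s)\<bar> \<le> \<bar>B\<bar> * (t' - t)"
    if t: "0 \<le> t" "t \<le> t'" "t' \<le> T" for s t t'
  proof -
    have i: "p s integrable_on {t..t'}"
      using integrable_on_subinterval[OF time_integrable[of s t']] t by auto
    have "integral {0..t} (p s) + integral {t..t'} (p s) = integral {0..t'} (p s)"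
      using t by (intro Henstock_Kurzweil_Integration.integral_combine time_integrable) auto
    moreover have "norm (integral {t..t'} (p s)) \<le> integral {t..t'} (\<lambda>_. \<bar>B\<bar>)"
    proof -
      \<comment> \<open>The bound \<open>B\<close> says nothing about the value at time 0, which is
        replaced by 0 on a null set.\<close>
      have e: "integral {t..t'} (p s) = integral {t..t'} (\<lambda>x. if x = 0 then 0 else p s x)"
        by (rule integral_spike[of "{0}"]) auto
      have i': "(\<lambda>x. if x = 0 then 0 else p s x) integrable_on {t..t'}"
        by (rule integrable_spike[OF i, of "{0}"]) auto
      show ?thesis unfolding e
      proof (rule integral_norm_bound_integral[OF i'])
        show "norm (if x = 0 then 0 else p s x) \<le> \<bar>B\<bar>" if "x \<in> {t..t'}" for x
          using B[of x s] that t by (cases "x = 0") auto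
      qed auto
    qed
    ultimately show ?thesis using t by (simp add: mult.commute)
  qed
  have "\<bar>integral {0..t} (p s) - integral {0..t'} (p s)\<bar> \<le> \<bar>B\<bar> * \<bar>t - t'\<bar>"
    if "t \<in> {0..T}" "t' \<in> {0..T}" for s t t'
    using half[of t t' s] half[of t' t s] that by (cases "t \<le> t'") (auto simp: abs_minus_commute)
  then show ?thesis by blast
qed

lemma time_integral_space_continuous: "continuous_on UNIV (\<lambda>s. integral {0..t} (p s))"
proof -
  obtain B where B: "\<And>s t'. t' \<in> {0<..t} \<Longrightarrow> \<bar>p s t'\<bar> \<le> B" using bdd by blast
  have eq: "integral {0..t} (p s) = integral {0<..t} (p s)" for s
    by (rule integral_spike_set) (rule negligible_subset[of "{0}"]; force)+
  show ?thesis
    unfolding eq continuous_on_sequentially comp_def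
  proof safe
    fix x :: "nat \<Rightarrow> real" and s assume x: "x \<longlonglongrightarrow> s"
    show "(\<lambda>n. integral {0<..t} (p (x n))) \<longlonglongrightarrow> integral {0<..t} (p s)"
    proof (rule dominated_convergence(2))
      show "(\<lambda>_. B) integrable_on {0<..t}"
        using integrable_const_ivl[of B 0 t]
        by (rule integrable_spike_set) (rule negligible_subset[of "{0}"]; force)+
      show "(\<lambda>n. p (x n) \<tau>) \<longlonglongrightarrow> p s \<tau>" if "\<tau> \<in> {0<..t}" for \<tau>
        using continuous_on_tendsto_compose[OF space_slice_continuous x, of \<tau>] that by auto
    qed (use B time_integrable_Ioc in auto)
  qed
qed

lemma time_integral_continuous:
  "continuous_on (UNIV \<times> {0..}) (\<lambda>(s,t). integral {0..t} (p s))"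
  by (intro jointly_continuous_if_locally_lipschitz_in_time time_integral_space_continuous
      time_integral_lipschitz)

text \<open>Instead of Fubini's theorem, the right-hand side is treated as a function
  \<open>J\<close> of the upper time limit: it is continuous down to 0, and for positive times the
  Leibniz rule differentiates it.\<close>

lemma time_space_integral_swap:
  assumes \<eta>: "continuous_on UNIV \<eta>" and T: "0 \<le> T"
  shows "((\<lambda>t. integral {a..b} (\<lambda>s. \<eta> s * p s t)) has_integral
    integral {a..b} (\<lambda>s. \<eta> s * integral {0..T} (p s))) {0..T}"
proof -
  define J where "J = (\<lambda>t. integral {a..b} (\<lambda>s. \<eta> s * integral {0..t} (p s)))"
  have \<eta>2: "continuous_on S (\<lambda>x. \<eta> (snd x))" for S :: "(real \<times> real) set"
    by (rule continuous_on_compose2[OF \<eta>]) (auto intro!: continuous_intros)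
  have "continuous_on ({0..T} \<times> cbox a b) (\<lambda>(t,s). \<eta> s * integral {0..t} (p s))"
    unfolding split_beta
    by (intro continuous_on_mult \<eta>2 continuous_on_compose2[OF time_integral_continuous[unfolded split_beta],
          where f = "\<lambda>x. (snd x, fst x)", simplified fst_conv snd_conv])
      (auto intro!: continuous_intros)
  from integral_continuous_on_param[OF this] have contJ: "continuous_on {0..T} J"
    by (simp add: J_def)
  have J': "(J has_real_derivative integral {a..b} (\<lambda>s. \<eta> s * p s t)) (at t)" if t: "0 < t" for t
  proof -
    have "((\<lambda>t. integral (cbox a b) (\<lambda>s. \<eta> s * integral {0..t} (p s))) has_field_derivative
        integral (cbox a b) (\<lambda>s. \<eta> s * p s t)) (at t within {0<..})"
    proof (rule leibniz_rule_field_derivative)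
      show "((\<lambda>t. \<eta> s * integral {0..t} (p s)) has_field_derivative \<eta> s * p s t) (at t within {0<..})"
        if "t \<in> {0<..}" for s t
        using that by (intro DERIV_cmult has_field_derivative_at_within[OF time_integral_derivative]) auto
      show "(\<lambda>s. \<eta> s * integral {0..t} (p s)) integrable_on cbox a b" for t
        by (intro integrable_continuous continuous_on_mult
            continuous_on_subset[OF time_integral_space_continuous] continuous_on_subset[OF \<eta>]) auto
      show "continuous_on ({0<..} \<times> cbox a b) (\<lambda>(t, s). \<eta> s * p s t)"
        unfolding split_beta
        by (intro continuous_on_mult \<eta>2 continuous_on_compose2[OF cont[unfolded split_beta],
              where f = "\<lambda>x. (snd x, fst x)", simplified fst_conv snd_conv])
          (auto intro!: continuous_intros)
    qed (use t in auto)
    then show ?thesis using t by (simp add: J_def at_within_open[of t "{0<..}"])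
  qed
  have "((\<lambda>t. integral {a..b} (\<lambda>s. \<eta> s * p s t)) has_integral (J T - J 0)) {0..T}"
    using J' by (intro fundamental_theorem_of_calculus_interior contJ T)
      (auto simp: has_real_derivative_iff_has_vector_derivative)
  then show ?thesis by (simp add: J_def)
qed

text \<open>Testing with the concave functions vanishing at \<open>a\<close> and \<open>b\<close> suffices: their second
  derivatives are all continuous functions \<open>\<le> 0\<close>.\<close>

lemma very_weak_solution_regularity:
  assumes w: "continuous_on UNIV w" and T: "0 < T"
    and weak: "\<And>a b \<psi> \<psi>' \<eta>. \<lbrakk>a < b; continuous_on UNIV \<eta>; \<And>s. \<eta> s \<le> 0;
        \<And>s. (\<psi> has_real_derivative \<psi>' s) (at s); \<And>s. (\<psi>' has_real_derivative \<eta> s) (at s);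
        \<psi> a = 0; \<psi> b = 0\<rbrakk> \<Longrightarrow>
      integral {0..T} (\<lambda>t. integral {a..b} (\<lambda>s. \<eta> s * p s t))
      = integral {a..b} (\<lambda>s. w s * \<psi> s) + integral {0..T} (\<lambda>t. p b t * \<psi>' b - p a t * \<psi>' a)"
  obtains Z' where "\<And>s. ((\<lambda>s. integral {0..T} (p s)) has_real_derivative Z' s) (at s)"
    "\<And>s. (Z' has_real_derivative w s) (at s)"
proof -
  define Z where "Z = (\<lambda>s. integral {0..T} (p s))"
  have Zc: "continuous_on UNIV Z" unfolding Z_def by (rule time_integral_space_continuous)
  \<comment> \<open>On a bounded interval \<open>Z\<close> is compared with the classical solution
    of \<open>G'' = w\<close> having the same boundary values. Green's identity for \<open>G\<close>
    matches the weak identity for \<open>Z\<close>, boundary terms included.\<close>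
  have zero: "Z s = G s"
    if ab: "a < b" "s \<in> {a..b}" and G: "\<And>s. (G has_real_derivative G' s) (at s)"
      "\<And>s. (G' has_real_derivative w s) (at s)" "G a = Z a" "G b = Z b" for a b G G' s
  proof -
    have Gc: "continuous_on UNIV G" "continuous_on UNIV G'"
      using G(1,2) by (meson DERIV_isCont continuous_at_imp_continuous_on)+
    have test: "integral {a..b} (\<lambda>s. \<eta> s * (Z s - G s)) = 0"
      if \<eta>: "continuous_on UNIV \<eta>" "\<And>s. \<eta> s \<le> 0" for \<eta>
    proof -
      obtain \<psi> \<psi>' where \<psi>: "\<And>s. (\<psi> has_real_derivative \<psi>' s) (at s)"
        "\<And>s. (\<psi>' has_real_derivative \<eta> s) (at s)" "\<psi> a = 0" "\<psi> b = 0"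
        by (rule continuous_has_second_antiderivative[OF \<eta>(1) ab(1), where \<alpha> = 0 and \<beta> = 0]) blast
      have \<psi>c: "continuous_on UNIV \<psi>" using \<psi>(1) by (meson DERIV_isCont continuous_at_imp_continuous_on)
      have "integral {0..T} (\<lambda>t. integral {a..b} (\<lambda>s. \<eta> s * p s t)) = integral {a..b} (\<lambda>s. \<eta> s * Z s)"
        using time_space_integral_swap[OF \<eta>(1), of T a b] T by (simp add: Z_def integral_unique)
      moreover have "integral {0..T} (\<lambda>t. p b t * \<psi>' b - p a t * \<psi>' a) = Z b * \<psi>' b - Z a * \<psi>' a"
        unfolding Z_def by (subst integral_diff) (auto intro!: integrable_on_mult_left time_integrable)
      moreover have "((\<lambda>s. \<eta> s * G s - w s * \<psi> s) has_integral
          (G b * \<psi>' b - G' b * \<psi> b) - (G a * \<psi>' a - G' a * \<psi> a)) {a..b}"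
      proof (rule fundamental_theorem_of_calculus)
        show "((\<lambda>s. G s * \<psi>' s - G' s * \<psi> s) has_vector_derivative \<eta> s * G s - w s * \<psi> s) (at s within {a..b})" for s
          unfolding has_real_derivative_iff_has_vector_derivative[symmetric]
          by (rule has_field_derivative_at_within) (auto intro!: derivative_eq_intros G(1,2) \<psi>(1,2))
      qed (use ab in simp)
      then have "integral {a..b} (\<lambda>s. \<eta> s * G s - w s * \<psi> s) = Z b * \<psi>' b - Z a * \<psi>' a"
        using \<psi>(3,4) G(3,4) by (simp add: integral_unique)
      moreover have "integral {a..b} (\<lambda>s. \<eta> s * G s - w s * \<psi> s)
          = integral {a..b} (\<lambda>s. \<eta> s * G s) - integral {a..b} (\<lambda>s. w s * \<psi> s)"
        by (intro integral_diff integrable_continuous_interval continuous_on_mult;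
            rule continuous_on_subset[OF _ subset_UNIV]) (use \<eta> Gc w \<psi>c in auto)
      moreover have "integral {a..b} (\<lambda>s. \<eta> s * Z s - \<eta> s * G s)
          = integral {a..b} (\<lambda>s. \<eta> s * Z s) - integral {a..b} (\<lambda>s. \<eta> s * G s)"
        by (intro integral_diff integrable_continuous_interval continuous_on_mult;
            rule continuous_on_subset[OF _ subset_UNIV]) (use \<eta> Gc Zc in auto)
      ultimately show ?thesis
        using weak[OF ab(1) \<eta> \<psi>] by (simp add: right_diff_distrib)
    qed
    have ZG: "continuous_on UNIV (\<lambda>s. Z s - G s)" using Zc Gc by (intro continuous_intros)
    \<comment> \<open>Taking minus the positive or negative part of \<open>Z - G\<close> as
      \<open>\<eta>\<close> respects the sign condition and turns the integrand into a
      square.\<close>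
    have sq: "max 0 (c * (Z s - G s)) = 0" if c: "c = 1 \<or> c = -1" for c :: real
    proof -
      have "continuous_on UNIV (\<lambda>s. - max 0 (c * (Z s - G s)))" by (intro continuous_intros ZG)
      from test[OF this] have "integral {a..b} (\<lambda>s. - (c * (- max 0 (c * (Z s - G s)) * (Z s - G s)))) = 0"
        by simp
      also have "(\<lambda>s. - (c * (- max 0 (c * (Z s - G s)) * (Z s - G s)))) = (\<lambda>s. (max 0 (c * (Z s - G s)))\<^sup>2)"
        by (auto simp: fun_eq_iff max_def power2_eq_square)
      finally have "\<forall>s\<in>{a..b}. (max 0 (c * (Z s - G s)))\<^sup>2 = 0"
        by (subst (asm) integral_eq_0_iff)
          (use ab in \<open>auto intro!: continuous_intros continuous_on_subset[OF ZG]\<close>)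
      then show ?thesis using ab by auto
    qed
    show ?thesis using sq[of 1] sq[of "-1"] by (simp add: max_def split: if_splits)
  qed
  obtain G G' where G: "\<And>s. (G has_real_derivative G' s) (at s)"
      "\<And>s. (G' has_real_derivative w s) (at s)" "G 0 = Z 0" "G 1 = Z 1"
    by (rule continuous_has_second_antiderivative[OF w zero_less_one, where \<alpha> = "Z 0" and \<beta> = "Z 1"]) blast
  have "Z s = G s" for s
  proof -
    \<comment> \<open>The interval contains \<open>s\<close>, 0 and 1. Its local solution
      \<open>H\<close> differs from the fixed \<open>G\<close> by an affine function that vanishes
      at 0 and 1, so one \<open>G\<close> serves the whole line.\<close>
    define a b where "a = min s 0" and "b = max s 1"
    have ab: "a < b" by (auto simp: a_def b_def)
    obtain H H' where H: "\<And>s. (H has_real_derivative H' s) (at s)"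
      "\<And>s. (H' has_real_derivative w s) (at s)" "H a = Z a" "H b = Z b"
      by (rule continuous_has_second_antiderivative[OF w ab, where \<alpha> = "Z a" and \<beta> = "Z b"]) blast
    have ZH: "Z x = H x" if "x \<in> {a..b}" for x
      by (rule zero[OF _ that H]) (auto simp: a_def b_def)
    have "((\<lambda>x. (H' x - G' x)) has_real_derivative 0) (at x)" for x
      by (auto intro!: derivative_eq_intros H(2) G(2))
    then have c: "H' x - G' x = H' 0 - G' 0" for x
      using DERIV_isconst_all[of "\<lambda>x. H' x - G' x"] by blast
    have e: "((\<lambda>x. H x - G x - (H' 0 - G' 0) * x) has_real_derivative H' x - G' x - (H' 0 - G' 0)) (at x)" for x
      by (auto intro!: derivative_eq_intros H(1) G(1))
    have "((\<lambda>x. H x - G x - (H' 0 - G' 0) * x) has_real_derivative 0) (at x)" for x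
      using e[of x] unfolding c[of x] by simp
    then have d: "H x - G x - (H' 0 - G' 0) * x = H y - G y - (H' 0 - G' 0) * y" for x y
      using DERIV_isconst_all[of "\<lambda>x. H x - G x - (H' 0 - G' 0) * x"] by blast
    have "H 0 = G 0" "H 1 = G 1" using ZH[of 0] ZH[of 1] G(3,4) by (auto simp: a_def b_def)
    then show ?thesis using d[of 0 1] d[of s 0] ZH[of s] by (auto simp: a_def b_def)
  qed
  then have "(\<lambda>s. integral {0..T} (p s)) = G" by (auto simp: Z_def)
  then show thesis using G by (intro that[of G']) simp_all
qed

end

section \<open>Logarithmic variables\<close>

lemma norm_e1: "norm (e1 :: 'a::euclidean_space) = 1"
proof -
  have "e1 \<in> (Basis :: 'a set)" unfolding e1_def by (rule someI_ex) (use nonempty_Basis in blast)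
  then show ?thesis by simp
qed

lemma integral_log_substitution:
  fixes f :: "real \<Rightarrow> real"
  assumes f: "continuous_on UNIV f" and ab: "a \<le> b"
  shows "integral {exp a..exp b} (\<lambda>r. f (ln r) / r) = integral {a..b} f"
proof -
  have "((\<lambda>r. (1 / r) *\<^sub>R f (ln r)) has_integral integral {ln (exp a)..ln (exp b)} f) {exp a..exp b}"
  proof (rule has_integral_substitution[where c = a and d = b])
    show "ln ` {exp a..exp b} \<subseteq> {a..b}"
    proof safe
      fix r assume r: "r \<in> {exp a..exp b}"
      then have "r > 0" using exp_gt_zero[of a] by (auto simp del: exp_gt_zero)
      then show "ln r \<in> {a..b}" using r ln_mono[of "exp a" r] ln_mono[of r "exp b"] by auto
    qed
    show "(ln has_real_derivative 1 / r) (at r within {exp a..exp b})" if "r \<in> {exp a..exp b}" for r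
    proof -
      have "r > 0" using that exp_gt_zero[of a] by (auto simp del: exp_gt_zero)
      then show ?thesis by (auto intro!: derivative_eq_intros)
    qed
  qed (use ab in \<open>auto intro: continuous_on_subset[OF f]\<close>)
  then show ?thesis by (simp add: integral_unique)
qed

lemma radial_solutionD:
  fixes u :: "'a::euclidean_space \<Rightarrow> real \<Rightarrow> real"
  assumes "radial_solution m u0 u"
  shows "0 \<le> u x t" and "radial (\<lambda>x. u x t)"
    and "continuous_on (UNIV \<times> {0<..}) (\<lambda>(x,t). u x t)"
    and "bounded ((\<lambda>(x,t). u x t) ` (UNIV \<times> {0..T}))"
    and "\<lbrakk>0 < r1; r1 < r2; 0 < T; C21_rect r1 r2 T phi phr phrr pht;
        \<And>r t. r \<in> {r1..r2} \<Longrightarrow> t \<in> {0..T} \<Longrightarrow> 0 \<le> phi r t;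
        \<And>t. t \<in> {0..T} \<Longrightarrow> phi r1 t = 0 \<and> phi r2 t = 0\<rbrakk> \<Longrightarrow>
        integral {0..T} (\<lambda>t. integral {r1..r2} (\<lambda>r.
            (rprof u r t * pht r t / r\<^sup>2 + (phrr r t + (real DIM('a) - 1) / r * phr r t) * rprof u r t powr m)
            * r powr (real DIM('a) - 1)))
        = integral {r1..r2} (\<lambda>r. (rprof u r T * phi r T - u0 (r *\<^sub>R e1) * phi r 0) / r\<^sup>2 * r powr (real DIM('a) - 1))
          + integral {0..T} (\<lambda>t. r2 powr (real DIM('a) - 1) * rprof u r2 t powr m * phr r2 t
                                 - r1 powr (real DIM('a) - 1) * rprof u r1 t powr m * phr r1 t)"
  using assms unfolding radial_solution_def Let_def by blast+

lemma radial_solution_log_continuous: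
  fixes u :: "'a::euclidean_space \<Rightarrow> real \<Rightarrow> real"
  assumes "radial_solution m u0 u"
  shows "continuous_on (UNIV \<times> {0<..}) (\<lambda>(s,t). u (exp s *\<^sub>R e1) t)"
  unfolding split_beta
  by (rule continuous_on_compose2[OF radial_solutionD(3)[OF assms, unfolded split_beta],
        where f = "\<lambda>p. (exp (fst p) *\<^sub>R e1, snd p)", simplified fst_conv snd_conv])
    (auto intro!: continuous_intros)

text \<open>For \<open>phi r = \<psi> (ln r)\<close> in dimension 2, the first-order terms of the
  radial Laplacian cancel and leave \<open>\<eta> (ln r) / r\<^sup>2\<close>. With the measure
  \<open>r dr\<close>, both this factor and the weight of the equation become \<open>ds\<close>, so
  all coefficients are constant.\<close>

lemma radial_solution_log_weak:
  fixes u :: "'a::euclidean_space \<Rightarrow> real \<Rightarrow> real"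
  assumes dim: "DIM('a) = 2" and sol: "radial_solution m u0 u" and m: "m > 1"
    and u0: "continuous_on UNIV u0" and ab: "a < b" and T: "0 < T"
    and \<eta>: "continuous_on UNIV \<eta>" "\<And>s. \<eta> s \<le> 0"
    and \<psi>: "\<And>s. (\<psi> has_real_derivative \<psi>' s) (at s)" "\<And>s. (\<psi>' has_real_derivative \<eta> s) (at s)"
      "\<psi> a = 0" "\<psi> b = 0"
  shows "integral {0..T} (\<lambda>t. integral {a..b} (\<lambda>s. \<eta> s * u (exp s *\<^sub>R e1) t powr m))
    = integral {a..b} (\<lambda>s. (u (exp s *\<^sub>R e1) T - u0 (exp s *\<^sub>R e1)) * \<psi> s)
      + integral {0..T} (\<lambda>t. u (exp b *\<^sub>R e1) t powr m * \<psi>' b - u (exp a *\<^sub>R e1) t powr m * \<psi>' a)"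
proof -
  define v where "v = (\<lambda>s t. u (exp s *\<^sub>R e1) t)"
  define w where "w = (\<lambda>s. (u (exp s *\<^sub>R e1) T - u0 (exp s *\<^sub>R e1)) * \<psi> s)"
  have cont\<psi>: "continuous_on UNIV \<psi>" "continuous_on UNIV \<psi>'"
    using \<psi>(1,2) by (meson DERIV_isCont continuous_at_imp_continuous_on)+
  have vcont: "continuous_on UNIV (\<lambda>s. v s t)" if "0 < t" for t
    using continuous_on_compose2[OF radial_solution_log_continuous[OF sol], of UNIV "\<lambda>s. (s, t)"] that
    by (fastforce simp: v_def intro!: continuous_intros)
  have wcont: "continuous_on UNIV w"
    unfolding w_def using vcont[OF T] unfolding v_def
    by (intro continuous_on_mult continuous_on_diff cont\<psi> continuous_on_compose2[OF u0])
      (auto intro!: continuous_intros)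
  have pos: "r > 0" if "r \<in> {exp a..exp b}" for r
    using that exp_gt_zero[of a] by (auto simp del: exp_gt_zero)
  have mem: "ln r \<in> {a..b}" if "r \<in> {exp a..exp b}" for r
    using that pos[OF that] ln_mono[of "exp a" r] ln_mono[of r "exp b"] by auto
  \<comment> \<open>\<open>\<psi>\<close> is concave and vanishes at both ends; nonnegativity is
    what makes it an admissible test function.\<close>
  have \<psi>pos: "0 \<le> \<psi> s" if "s \<in> {a..b}" for s
  proof -
    define l where "l = (b - s) / (b - a)"
    have l: "0 \<le> l" "l \<le> 1" using that ab by (auto simp: l_def)
    have "l * (b - a) = b - s" using ab by (simp add: l_def)
    then have s: "l * a + (1 - l) * b = s" by (simp add: algebra_simps)
    have "- \<psi> (l * a + (1 - l) * b) \<le> l * - \<psi> a + (1 - l) * - \<psi> b + 0 * (l * (1 - l) * (a - b)\<^sup>2 / 2)"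
      by (rule chord_bound_second_derivative[where f' = "\<lambda>s. - \<psi>' s" and f'' = "\<lambda>s. - \<eta> s"])
        (use l \<eta> in \<open>auto intro!: derivative_eq_intros \<psi>(1,2)\<close>)
    then show ?thesis unfolding s using \<psi>(3,4) by simp
  qed
  let ?phi = "\<lambda>r (t::real). \<psi> (ln r)" and ?phr = "\<lambda>r (t::real). \<psi>' (ln r) / r"
  let ?phrr = "\<lambda>r (t::real). (\<eta> (ln r) - \<psi>' (ln r)) / r\<^sup>2" and ?pht = "\<lambda>(r::real) (t::real). 0 :: real"
  have dln: "(ln has_real_derivative 1 / r) (at r within {exp a..exp b})" if "r \<in> {exp a..exp b}" for r
    using pos[OF that] by (auto intro!: derivative_eq_intros)
  have lncont: "continuous_on ({exp a..exp b} \<times> {0..T}) (\<lambda>p. F (ln (fst p)))"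
    if "continuous_on UNIV F" for F :: "real \<Rightarrow> real"
    by (rule continuous_on_compose2[OF that]) (use pos in \<open>force intro!: continuous_intros\<close>)+
  have C21: "C21_rect (exp a) (exp b) T ?phi ?phr ?phrr ?pht"
    unfolding C21_rect_def
  proof (intro conjI ballI)
    fix r t assume r: "r \<in> {exp a..exp b}"
    show d1: "((\<lambda>s. \<psi> (ln s)) has_real_derivative \<psi>' (ln r) / r) (at r within {exp a..exp b})"
      using DERIV_chain2[OF \<psi>(1) dln[OF r]] by simp
    have d2: "((\<lambda>s. \<psi>' (ln s)) has_real_derivative \<eta> (ln r) * (1 / r)) (at r within {exp a..exp b})"
      by (rule DERIV_chain2[OF \<psi>(2) dln[OF r]])
    show "((\<lambda>s. \<psi>' (ln s) / s) has_real_derivative (\<eta> (ln r) - \<psi>' (ln r)) / r\<^sup>2) (at r within {exp a..exp b})"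
      using DERIV_divide[OF d2 DERIV_ident] pos[OF r] by (simp add: power2_eq_square)
  next
    show "continuous_on ({exp a..exp b} \<times> {0..T}) (\<lambda>(r, t). \<psi> (ln r))"
      unfolding split_beta by (rule lncont[OF cont\<psi>(1)])
    show "continuous_on ({exp a..exp b} \<times> {0..T}) (\<lambda>(r, t). \<psi>' (ln r) / r)"
      unfolding split_beta using pos
      by (intro continuous_on_divide lncont[OF cont\<psi>(2)]) (force intro!: continuous_intros)+
    show "continuous_on ({exp a..exp b} \<times> {0..T}) (\<lambda>(r, t). (\<eta> (ln r) - \<psi>' (ln r)) / r\<^sup>2)"
      unfolding split_beta using pos
      by (intro continuous_on_divide continuous_on_diff lncont[OF cont\<psi>(2)] lncont[OF \<eta>(1)])
        (force intro!: continuous_intros)+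
  qed (auto intro!: derivative_eq_intros)
  have W: "integral {0..T} (\<lambda>t. integral {exp a..exp b} (\<lambda>r.
            (rprof u r t * 0 / r\<^sup>2 + ((\<eta> (ln r) - \<psi>' (ln r)) / r\<^sup>2 + (real DIM('a) - 1) / r * (\<psi>' (ln r) / r)) * rprof u r t powr m)
            * r powr (real DIM('a) - 1)))
        = integral {exp a..exp b} (\<lambda>r. (rprof u r T * \<psi> (ln r) - u0 (r *\<^sub>R e1) * \<psi> (ln r)) / r\<^sup>2 * r powr (real DIM('a) - 1))
          + integral {0..T} (\<lambda>t. exp b powr (real DIM('a) - 1) * rprof u (exp b) t powr m * (\<psi>' (ln (exp b)) / exp b)
                                 - exp a powr (real DIM('a) - 1) * rprof u (exp a) t powr m * (\<psi>' (ln (exp a)) / exp a))"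
    by (rule radial_solutionD(5)[OF sol _ _ T C21]) (use ab \<psi> \<psi>pos mem in auto)
  have L: "integral {0..T} (\<lambda>t. integral {exp a..exp b} (\<lambda>r.
            (rprof u r t * 0 / r\<^sup>2 + ((\<eta> (ln r) - \<psi>' (ln r)) / r\<^sup>2 + (real DIM('a) - 1) / r * (\<psi>' (ln r) / r)) * rprof u r t powr m)
            * r powr (real DIM('a) - 1)))
      = integral {0..T} (\<lambda>t. integral {a..b} (\<lambda>s. \<eta> s * v s t powr m))"
  \<comment> \<open>Time 0 is discarded because continuity of the solution in space is known only at
    positive times.\<close>
  proof (rule integral_spike[of "{0}"])
    fix t assume "t \<in> {0..T} - {0}"
    then have t: "0 < t" by auto
    have "integral {a..b} (\<lambda>s. \<eta> s * v s t powr m)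
        = integral {exp a..exp b} (\<lambda>r. \<eta> (ln r) * v (ln r) t powr m / r)"
      by (rule integral_log_substitution[symmetric])
        (use ab m vcont[OF t] \<eta> in \<open>auto intro!: continuous_intros continuous_on_powr' simp: v_def radial_solutionD(1)[OF sol]\<close>)
    also have "\<dots> = integral {exp a..exp b} (\<lambda>r.
            (rprof u r t * 0 / r\<^sup>2 + ((\<eta> (ln r) - \<psi>' (ln r)) / r\<^sup>2 + (real DIM('a) - 1) / r * (\<psi>' (ln r) / r)) * rprof u r t powr m)
            * r powr (real DIM('a) - 1))"
    proof (rule integral_cong)
      fix r assume r: "r \<in> {exp a..exp b}"
      show "\<eta> (ln r) * v (ln r) t powr m / r =
            (rprof u r t * 0 / r\<^sup>2 + ((\<eta> (ln r) - \<psi>' (ln r)) / r\<^sup>2 + (real DIM('a) - 1) / r * (\<psi>' (ln r) / r)) * rprof u r t powr m)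
            * r powr (real DIM('a) - 1)"
        using pos[OF r] by (simp add: dim v_def rprof_def power2_eq_square diff_divide_distrib)
    qed
    finally show "integral {a..b} (\<lambda>s. \<eta> s * v s t powr m) = \<dots>" .
  qed simp
  have R1: "integral {exp a..exp b} (\<lambda>r. (rprof u r T * \<psi> (ln r) - u0 (r *\<^sub>R e1) * \<psi> (ln r)) / r\<^sup>2 * r powr (real DIM('a) - 1))
      = integral {a..b} w"
  proof -
    have "integral {a..b} w = integral {exp a..exp b} (\<lambda>r. w (ln r) / r)"
      by (rule integral_log_substitution[symmetric]) (use ab wcont in auto)
    also have "\<dots> = integral {exp a..exp b} (\<lambda>r. (rprof u r T * \<psi> (ln r) - u0 (r *\<^sub>R e1) * \<psi> (ln r)) / r\<^sup>2 * r powr (real DIM('a) - 1))"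
    proof (rule integral_cong)
      fix r assume r: "r \<in> {exp a..exp b}"
      show "w (ln r) / r = (rprof u r T * \<psi> (ln r) - u0 (r *\<^sub>R e1) * \<psi> (ln r)) / r\<^sup>2 * r powr (real DIM('a) - 1)"
      proof -
        have "w (ln r) = rprof u r T * \<psi> (ln r) - u0 (r *\<^sub>R e1) * \<psi> (ln r)"
          using pos[OF r] by (simp add: w_def rprof_def left_diff_distrib)
        then show ?thesis using pos[OF r] by (simp add: dim power2_eq_square)
      qed
    qed
    finally show ?thesis by simp
  qed
  have R2: "integral {0..T} (\<lambda>t. exp b powr (real DIM('a) - 1) * rprof u (exp b) t powr m * (\<psi>' (ln (exp b)) / exp b)
        - exp a powr (real DIM('a) - 1) * rprof u (exp a) t powr m * (\<psi>' (ln (exp a)) / exp a))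
      = integral {0..T} (\<lambda>t. v b t powr m * \<psi>' b - v a t powr m * \<psi>' a)"
    by (rule integral_cong) (simp add: dim v_def rprof_def)
  show ?thesis using W unfolding L R1 R2 unfolding v_def w_def .
qed

text \<open>\<open>Q\<close> is a second primitive of the data plus the time integral of
  \<open>v powr m\<close>. The regularity result gives this integral the second space derivative
  \<open>v - v0\<close>, so that of \<open>Q\<close> is \<open>v\<close>.\<close>

lemma radial_solution_potential:
  fixes u :: "'a::euclidean_space \<Rightarrow> real \<Rightarrow> real"
  assumes dim: "DIM('a) = 2" and sol: "radial_solution m u0 u" and m: "m > 1"
    and u0: "continuous_on UNIV u0"
  obtains Q Q' Q0' where "potential m (\<lambda>s t. u (exp s *\<^sub>R e1) t) Q Q'"
    "\<And>s. ((\<lambda>s. Q s 0) has_real_derivative Q0' s) (at s)"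
    "\<And>s. (Q0' has_real_derivative u0 (exp s *\<^sub>R e1)) (at s)"
proof -
  define v where "v = (\<lambda>s t. u (exp s *\<^sub>R e1) t)"
  define v0 where "v0 = (\<lambda>s. u0 (exp s *\<^sub>R e1))"
  define p where "p = (\<lambda>s t. v s t powr m)"
  have vnn: "0 \<le> v s t" for s t using radial_solutionD(1)[OF sol] by (simp add: v_def)
  have vB: "\<exists>B. \<forall>s. \<forall>t\<in>{0<..T}. v s t \<le> B" for T
  proof -
    obtain B where B: "\<forall>y\<in>(\<lambda>(x,t). u x t) ` (UNIV \<times> {0..T}). norm y \<le> B"
      using radial_solutionD(4)[OF sol, of T] unfolding bounded_iff by blast
    have "v s t \<le> B" if "t \<in> {0<..T}" for s t
    proof -
      have "v s t \<in> (\<lambda>(x,t). u x t) ` (UNIV \<times> {0..T})"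
        using that unfolding v_def by (intro image_eqI[of _ _ "(exp s *\<^sub>R e1, t)"]) auto
      then show ?thesis using B abs_le_D1 by (metis real_norm_def)
    qed
    then show ?thesis by blast
  qed
  have vcont: "continuous_on (UNIV \<times> {0<..}) (\<lambda>(s,t). v s t)"
    unfolding v_def by (rule radial_solution_log_continuous[OF sol])
  have pcont: "continuous_on (UNIV \<times> {0<..}) (\<lambda>(s,t). p s t)"
    using vcont m vnn unfolding p_def split_beta
    by (intro continuous_on_powr' continuous_intros) auto
  have pB: "\<exists>B. \<forall>s. \<forall>t\<in>{0<..T}. \<bar>p s t\<bar> \<le> B" for T
  proof -
    obtain B where "\<And>s t. t \<in> {0<..T} \<Longrightarrow> v s t \<le> B" using vB by blast
    then have "\<bar>p s t\<bar> \<le> B powr m" if "t \<in> {0<..T}" for s t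
      using that vnn m by (auto simp: p_def intro!: powr_mono2)
    then show ?thesis by blast
  qed
  have v0cont: "continuous_on UNIV v0"
    unfolding v0_def by (rule continuous_on_compose2[OF u0]) (auto intro!: continuous_intros)
  obtain Q0' where Q0': "\<And>s. (Q0' has_real_derivative v0 s) (at s)"
    using continuous_has_antiderivative[OF v0cont] by blast
  then have "continuous_on UNIV Q0'" by (meson DERIV_isCont continuous_at_imp_continuous_on)
  then obtain Q0 where Q0: "\<And>s. (Q0 has_real_derivative Q0' s) (at s)"
    using continuous_has_antiderivative by blast
  have "\<exists>Z'. \<forall>s. ((\<lambda>s. integral {0..t} (p s)) has_real_derivative Z' s) (at s) \<and>
    (Z' has_real_derivative v s t - v0 s) (at s)" if t: "0 < t" for t
  proof -
    have vt: "continuous_on UNIV (\<lambda>s. v s t)"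
      using continuous_on_compose2[OF vcont, of UNIV "\<lambda>s. (s, t)"] t by (fastforce intro!: continuous_intros)
    have wc: "continuous_on UNIV (\<lambda>s. v s t - v0 s)" by (intro continuous_intros vt v0cont)
    show ?thesis
    proof (rule very_weak_solution_regularity[OF pcont pB wc t])
      fix a b \<psi> \<psi>' \<eta>
      assume "a < b" "continuous_on UNIV \<eta>" "\<And>s. \<eta> s \<le> 0"
        "\<And>s. (\<psi> has_real_derivative \<psi>' s) (at s)" "\<And>s. (\<psi>' has_real_derivative \<eta> s) (at s)"
        "\<psi> a = 0" "\<psi> b = 0"
      from radial_solution_log_weak[OF dim sol m u0 this(1) t this(2-)]
      show "integral {0..t} (\<lambda>t. integral {a..b} (\<lambda>s. \<eta> s * p s t))
        = integral {a..b} (\<lambda>s. (v s t - v0 s) * \<psi> s) + integral {0..t} (\<lambda>t. p b t * \<psi>' b - p a t * \<psi>' a)"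
        by (simp add: p_def v_def v0_def)
    qed blast
  qed
  then obtain Z' where Z': "\<And>t s. 0 < t \<Longrightarrow> ((\<lambda>s. integral {0..t} (p s)) has_real_derivative Z' t s) (at s)"
    "\<And>t s. 0 < t \<Longrightarrow> (Z' t has_real_derivative v s t - v0 s) (at s)" by metis
  have "continuous_on UNIV Q0" using Q0 by (meson DERIV_isCont continuous_at_imp_continuous_on)
  then have Q0c: "continuous_on (UNIV \<times> {0..}) (\<lambda>x :: real \<times> real. Q0 (fst x))"
    by (rule continuous_on_compose2) (auto intro!: continuous_intros)
  define Q where "Q = (\<lambda>s t. Q0 s + integral {0..t} (p s))"
  have pot: "potential m v Q (\<lambda>s t. Q0' s + Z' t s)"
    unfolding potential_def
  proof (intro conjI allI impI vB vnn)
    show "continuous_on (UNIV \<times> {0..}) (\<lambda>(s, t). Q s t)"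
      using time_integral_continuous[OF pcont pB] Q0c unfolding Q_def split_beta
      by (intro continuous_on_add)
    fix s t :: real assume t: "0 < t"
    show "((\<lambda>s. Q s t) has_real_derivative Q0' s + Z' t s) (at s)"
      unfolding Q_def by (intro DERIV_add Q0 Z' t)
    show "((\<lambda>s. Q0' s + Z' t s) has_real_derivative v s t) (at s)"
      using DERIV_add[OF Q0' Z'(2)[OF t], of s] by simp
    show "(Q s has_real_derivative v s t powr m) (at t)"
      using DERIV_add[OF DERIV_const[of "Q0 s"] time_integral_derivative[OF pcont pB t, of s]]
      by (simp add: Q_def p_def)
  qed
  show thesis
  proof (rule that)
    show "potential m (\<lambda>s t. u (exp s *\<^sub>R e1) t) Q (\<lambda>s t. Q0' s + Z' t s)" using pot by (simp add: v_def)
    show "((\<lambda>s. Q s 0) has_real_derivative Q0' s) (at s)" for s using Q0 by (simp add: Q_def)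
    show "(Q0' has_real_derivative u0 (exp s *\<^sub>R e1)) (at s)" for s using Q0' by (simp add: v0_def)
  qed
qed

section \<open>Value at the origin and convergence to the profile\<close>

theorem theorem1p2:
  fixes m K :: real and u0 :: "real^2 \<Rightarrow> real" and u :: "real^2 \<Rightarrow> real \<Rightarrow> real"
  assumes "m > 1"
    and "bounded (range u0)" and "continuous_on UNIV u0" and "\<forall>x. 0 \<le> u0 x"
    and "radial u0"
    and "u0 0 = K" and "K > 0"
    and "(u0 \<longlongrightarrow> 0) at_infinity"
    and "radial_solution m u0 u"
  shows "(\<exists>f :: real \<Rightarrow> real.
            let W = (\<lambda>x t. if x = 0 then K else f (ln (norm x) / sqrt t)) in
            (\<forall>\<epsilon>>0. \<forall>\<^sub>F t in at_top. \<forall>x. \<bar>u x t - W x t\<bar> \<le> \<epsilon>))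
         \<and> (\<forall>t>0. u 0 t = K)"
proof -
  note m = assms(1) and sol = assms(9) and K = assms(7)
  define v where "v = (\<lambda>s t. u (exp s *\<^sub>R e1) t)"
  define v0 where "v0 = (\<lambda>s. u0 (exp s *\<^sub>R e1))"
  obtain Q Q' Q0' where Q: "potential m v Q Q'"
    and Q1: "\<And>s. ((\<lambda>s. Q s 0) has_real_derivative Q0' s) (at s)"
    and Q2: "\<And>s. (Q0' has_real_derivative v0 s) (at s)"
    using radial_solution_potential[OF _ sol m assms(3)] unfolding v_def v0_def by auto
  obtain M where M: "\<And>x. \<bar>u0 x\<bar> \<le> M" using assms(2) by (auto simp: bounded_iff)
  have v0: "0 \<le> v0 s" "v0 s \<le> M" for s
    using assms(4) abs_le_D1[OF M] by (auto simp: v0_def)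
  have KM: "K \<le> M" using abs_le_D1[OF M[of 0]] assms(6) by simp
  have lim_bot: "(v0 \<longlongrightarrow> K) at_bot"
  proof -
    have "((\<lambda>s::real. exp s *\<^sub>R (e1 :: real^2)) \<longlongrightarrow> 0 *\<^sub>R e1) at_bot"
      by (intro tendsto_intros exp_at_bot)
    then have "((\<lambda>s::real. exp s *\<^sub>R (e1 :: real^2)) \<longlongrightarrow> 0) at_bot" by simp
    from continuous_on_tendsto_compose[OF assms(3) this] show ?thesis
      using assms(6) by (simp add: v0_def)
  qed
  have lim_top: "(v0 \<longlongrightarrow> 0) at_top"
  proof -
    have "filterlim (\<lambda>s::real. exp s *\<^sub>R (e1 :: real^2)) at_infinity at_top"
      by (rule filterlim_norm_at_top_imp_at_infinity) (simp add: norm_e1 exp_at_top)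
    from filterlim_compose[OF assms(8) this] show ?thesis by (simp add: v0_def)
  qed
  have uv: "u x t = v (ln (norm x)) t" if "x \<noteq> 0" for x t
  proof -
    have "norm x = norm (exp (ln (norm x)) *\<^sub>R (e1 :: real^2))" using that by (simp add: norm_e1)
    then show ?thesis using radial_solutionD(2)[OF sol, of t] unfolding radial_def v_def by blast
  qed
  \<comment> \<open>As \<open>s\<close> tends to minus infinity, the time average of
    \<open>v powr m\<close> over a short interval after \<open>t\<close> tends to
    \<open>K powr m\<close>. By the mean value theorem it is attained at a point close to
    \<open>(0, t)\<close>, where continuity compares it with \<open>u 0 t powr m\<close>.\<close>
  have origin: "u 0 t = K" if t: "0 < t" for t
  proof (rule ccontr)
    assume "u 0 t \<noteq> K"
    \<comment> \<open>Two errors, each strictly below \<open>e\<close>, then add up to less than the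
      full difference, a contradiction.\<close>
    define e where "e = \<bar>u 0 t powr m - K powr m\<bar> / 2"
    have u0t: "0 \<le> u 0 t" using radial_solutionD(1)[OF sol] .
    have "u 0 t powr m \<noteq> K powr m"
      using \<open>u 0 t \<noteq> K\<close> u0t K m powr_less_mono2[of m "u 0 t" K] powr_less_mono2[of m K "u 0 t"]
      by (cases "u 0 t < K") auto
    then have e: "e > 0" by (simp add: e_def)
    have "continuous_on (UNIV \<times> {0<..}) (\<lambda>p. u (fst p) (snd p) powr m)"
      using radial_solutionD(3)[OF sol] m radial_solutionD(1)[OF sol] unfolding split_beta
      by (intro continuous_on_powr' continuous_intros) auto
    moreover have "(0, t) \<in> (UNIV :: (real^2) set) \<times> {0<..}" using t by simp
    ultimately obtain d where d: "d > 0" and d': "\<forall>q\<in>UNIV \<times> {0<..}. dist q (0 :: real^2, t) < d \<longrightarrow>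
        dist (u (fst q) (snd q) powr m) (u (fst (0 :: real^2, t)) (snd (0 :: real^2, t)) powr m) < e"
      using e unfolding continuous_on_iff by meson
    have near: "\<bar>u x \<tau> powr m - u 0 t powr m\<bar> < e" if "0 < \<tau>" "dist (x, \<tau>) (0, t) < d" for x \<tau>
      using d'[rule_format, of "(x, \<tau>)"] that by (simp add: dist_real_def)
    \<comment> \<open>With space and time displacements both below \<open>d / 2\<close>, the chosen
      point stays within distance \<open>d\<close> of \<open>(0, t)\<close>.\<close>
    define h where "h = d / 2"
    have h: "h > 0" using d by (simp add: h_def)
    have "((\<lambda>s. (Q s (t + h) - Q s 0) - (Q s t - Q s 0)) \<longlongrightarrow> K powr m * (t + h) - K powr m * t) at_bot"
      using t h K KM by (intro tendsto_diff potential_left_limit[OF m Q Q1 Q2 v0 _ _ lim_bot]) auto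
    then have "((\<lambda>s. Q s (t + h) - Q s t) \<longlongrightarrow> K powr m * h) at_bot" by (simp add: algebra_simps)
    from tendstoD[OF this, of "e * h"] have "\<forall>\<^sub>F s in at_bot. \<bar>Q s (t + h) - Q s t - K powr m * h\<bar> < e * h"
      using e h by (simp add: dist_real_def)
    moreover have "\<forall>\<^sub>F s in at_bot. s < ln (d / 2)" by (rule eventually_gt_at_bot)
    ultimately have "\<forall>\<^sub>F s in at_bot. \<bar>Q s (t + h) - Q s t - K powr m * h\<bar> < e * h \<and> s < ln (d / 2)"
      by (rule eventually_conj)
    then obtain s where s: "\<bar>Q s (t + h) - Q s t - K powr m * h\<bar> < e * h" "s < ln (d / 2)"
      using eventually_happens'[OF trivial_limit_at_bot_linorder] by blast
    have "\<exists>z>t. z < t + h \<and> Q s (t + h) - Q s t = (t + h - t) * (v s z powr m)"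
      by (rule MVT2) (use h t potentialD(6)[OF Q] in auto)
    then obtain z where z: "t < z" "z < t + h" "Q s (t + h) - Q s t = h * v s z powr m" by auto
    have "exp s < d / 2" using s(2) d by (metis exp_less_cancel_iff exp_ln half_gt_zero)
    then have "dist (exp s *\<^sub>R (e1 :: real^2)) 0 < d / 2" by (simp add: norm_e1)
    moreover have "dist z t < d / 2" using z by (simp add: h_def dist_real_def)
    ultimately have "dist (exp s *\<^sub>R e1, z) (0 :: real^2, t) < d"
      using sqrt_sum_squares_le_sum[of "dist (exp s *\<^sub>R (e1 :: real^2)) 0" "dist z t"]
      by (simp add: dist_Pair_Pair)
    from near[OF _ this] have "\<bar>v s z powr m - u 0 t powr m\<bar> < e" using z t by (simp add: v_def)
    then have "h * \<bar>v s z powr m - u 0 t powr m\<bar> < h * e" using h by simp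
    then have "\<bar>h * v s z powr m - h * u 0 t powr m\<bar> < h * e"
      using h by (simp add: abs_mult flip: right_diff_distrib)
    then have "\<bar>h * u 0 t powr m - h * K powr m\<bar> < 2 * (h * e)"
      using s(1) unfolding z(3) mult.commute[of e h] mult.commute[of "K powr m" h] by linarith
    moreover have "\<bar>h * u 0 t powr m - h * K powr m\<bar> = h * \<bar>u 0 t powr m - K powr m\<bar>"
      using h by (simp add: abs_mult flip: right_diff_distrib)
    ultimately have "h * \<bar>u 0 t powr m - K powr m\<bar> < h * (2 * e)" by simp
    then have "\<bar>u 0 t powr m - K powr m\<bar> < 2 * e" using h by simp
    then show False by (simp add: e_def)
  qed
  \<comment> \<open>The solution in the self-similar variable; dilating by
    \<open>sqrt (t' / t)\<close> carries its value at time \<open>t\<close> to that at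
    \<open>t'\<close> for the same \<open>\<zeta>\<close>.\<close>
  define g where "g = (\<lambda>t \<zeta>. v (sqrt t * \<zeta>) t)"
  have cauchy: "\<exists>T>0. \<forall>t\<ge>T. \<forall>t'\<ge>t. \<forall>\<zeta>. \<bar>g t' \<zeta> - g t \<zeta>\<bar> \<le> \<delta>" if \<delta>: "\<delta> > 0" for \<delta>
  proof -
    have "0 < M" using K KM by simp
    from dilations_asymptotically_equal[OF m Q Q1 Q2 v0 this lim_bot lim_top \<delta>]
    obtain T where T: "T > 0" and close: "\<And>t a s. T \<le> t \<Longrightarrow> 1 \<le> a \<Longrightarrow> \<bar>v (a * s) (a\<^sup>2 * t) - v s t\<bar> \<le> \<delta>"
      by blast
    have "\<bar>g t' \<zeta> - g t \<zeta>\<bar> \<le> \<delta>" if "T \<le> t" "t \<le> t'" for t t' \<zeta>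
    proof -
      have "sqrt (t' / t) * sqrt t = sqrt t'" "(sqrt (t' / t))\<^sup>2 * t = t'"
        using that T by (simp_all add: real_sqrt_divide power_divide)
      then show ?thesis
        using close[of t "sqrt (t' / t)" "sqrt t * \<zeta>"] that T by (simp add: g_def flip: mult.assoc)
    qed
    then show ?thesis using T by blast
  qed
  have "\<exists>l. (\<lambda>n. g (real n) \<zeta>) \<longlonglongrightarrow> l" for \<zeta>
  proof -
    have "Cauchy (\<lambda>n. g (real n) \<zeta>)"
    proof (rule CauchyI')
      fix e :: real assume "e > 0"
      then obtain T where T: "\<And>t t'. T \<le> t \<Longrightarrow> t \<le> t' \<Longrightarrow> \<bar>g t' \<zeta> - g t \<zeta>\<bar> \<le> e / 2"
        using cauchy[of "e / 2"] by auto
      obtain N :: nat where "T \<le> real N" using real_arch_simple by blast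
      then have "dist (g (real a) \<zeta>) (g (real b) \<zeta>) < e" if "N \<le> a" "a < b" for a b
        using T[of "real a" "real b"] that \<open>e > 0\<close> by (simp add: dist_real_def abs_minus_commute)
      then show "\<exists>N. \<forall>a\<ge>N. \<forall>b>a. dist (g (real a) \<zeta>) (g (real b) \<zeta>) < e" by blast
    qed
    then show ?thesis by (simp add: Cauchy_convergent_iff convergent_def)
  qed
  \<comment> \<open>Integer times suffice to define the profile, since the Cauchy estimate is
    uniform in \<open>\<zeta>\<close> and holds for all real times.\<close>
  then obtain f where f: "\<And>\<zeta>. (\<lambda>n. g (real n) \<zeta>) \<longlonglongrightarrow> f \<zeta>" by metis
  have limit: "\<forall>\<^sub>F t in at_top. \<forall>x. \<bar>u x t - (if x = 0 then K else f (ln (norm x) / sqrt t))\<bar> \<le> \<epsilon>"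
    if \<epsilon>: "\<epsilon> > 0" for \<epsilon>
  proof -
    obtain T where T: "T > 0" "\<And>t t' \<zeta>. T \<le> t \<Longrightarrow> t \<le> t' \<Longrightarrow> \<bar>g t' \<zeta> - g t \<zeta>\<bar> \<le> \<epsilon>"
      using cauchy[OF \<epsilon>] by blast
    have close: "\<bar>g t \<zeta> - f \<zeta>\<bar> \<le> \<epsilon>" if t: "T \<le> t" for t \<zeta>
    proof -
      have "(\<lambda>n. \<bar>g (real n) \<zeta> - g t \<zeta>\<bar>) \<longlonglongrightarrow> \<bar>f \<zeta> - g t \<zeta>\<bar>" by (intro tendsto_intros f)
      moreover have "\<exists>N. \<forall>n\<ge>N. \<bar>g (real n) \<zeta> - g t \<zeta>\<bar> \<le> \<epsilon>"
      proof -
        obtain N :: nat where "t \<le> real N" using real_arch_simple by blast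
        then show ?thesis using T(2)[OF t] by (meson of_nat_mono order_trans)
      qed
      ultimately show ?thesis by (simp add: LIMSEQ_le_const2 abs_minus_commute)
    qed
    have "\<bar>u x t - (if x = 0 then K else f (ln (norm x) / sqrt t))\<bar> \<le> \<epsilon>" if t: "T \<le> t" for x t
    proof (cases "x = 0")
      case True
      then show ?thesis using origin[of t] t T \<epsilon> by simp
    next
      case False
      have "u x t = g t (ln (norm x) / sqrt t)" using uv[OF False, of t] t T by (simp add: g_def)
      then show ?thesis using close[OF t, of "ln (norm x) / sqrt t"] False by simp
    qed
    then show ?thesis unfolding eventually_at_top_linorder by blast
  qed
  show ?thesis unfolding Let_def using limit origin by blast
qed

end
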